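(* Let $G_1$ and $H_1$ be cospectral regular graphs, and let $G_2$ and $H_2$ be non-isomorphic, regular and cospectral graphs. Then $G_1\underset{=}{\vee}G_2$ and $H_1\underset{=}{\vee}H_2$ are non-regular and $\{A,L,Q,\mathcal L\}$NICS.
   Context: Graphs are finite, undirected and simple. $A(G)$ is the adjacency matrix, $D(G)$ the diagonal degree matrix, $L(G)=D(G)-A(G)$ the Laplacian, $Q(G)=D(G)+A(G)$ the signless Laplacian, and $\mathcal L(G)=I-D(G)^{-1/2}A(G)D(G)^{-1/2}$ the normalized Laplacian (with the convention that for a vertex of degree $0$ one sets $d_i^{-1/2}=0$ and the corresponding diagonal entry of $\mathcal L(G)$ is $0$). For $X\in\{A,L,Q,\mathcal L\}$ two graphs are $X$-cospectral if $X(\cdot)$ has the same eigenvalues with multiplicities for both. For $S\subseteq\{A,L,Q,\mathcal L\}$, two graphs are $S$NICS if they are non-isomorphic and $X$-cospectral for every $X\in S$. Two regular graphs are called cospectral if they are $X$-cospectral for any (equivalently, all) $X\in\{A,L,Q,\mathcal L\}$. For vertex-disjoint graphs $G_1$ (with $V(G_1)=\{u_1,\dots,u_{n_1}\}$) and $G_2$, the join $G_1\vee G_2$ is the disjoint union together with all edges between $V(G_1)$ and $V(G_2)$. The NNS (Non Neighbors Splitting) join $G_1\underset{=}{\vee}G_2$ is obtained from $G_1\vee G_2$ by adding new vertices $u_1',\dots,u_{n_1}'$ and joining $u_i'$ to $u_j$ if and only if $i\ne j$ and $u_iu_j\notin E(G_1)$. *)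

theory Defs
  imports
    "Graph_Theory.Pair_Digraph"
    "Graph_Theory.Digraph_Isomorphism"
    "Jordan_Normal_Form.Char_Poly"
begin

text \<open>
  A finite simple undirected graph is a \<^locale>\<open>pair_graph\<close>: a finite, loop-free, symmetric
  digraph without parallel arcs. The edge \<open>uv\<close> is the pair of arcs \<open>(u, v)\<close>, \<open>(v, u)\<close>, so the
  number of arcs leaving a vertex is its degree, and \<^const>\<open>digraph_iso\<close> is graph isomorphism.
\<close>

definition degree_of :: "'a pair_pre_digraph \<Rightarrow> 'a \<Rightarrow> nat" where
  "degree_of G v = out_degree (with_proj G) v"

definition regular :: "'a pair_pre_digraph \<Rightarrow> bool" where
  "regular G \<longleftrightarrow> (\<exists>r. \<forall>v \<in> pverts G. degree_of G v = r)"

definition isomorphic :: "'a pair_pre_digraph \<Rightarrow> 'b pair_pre_digraph \<Rightarrow> bool" where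
  "isomorphic G H \<longleftrightarrow> digraph_iso (with_proj G) (with_proj H)"

text \<open>
  The matrices of a graph are written with respect to some fixed enumeration of its vertices; a
  different enumeration conjugates them by a permutation matrix and does not change the spectrum.
\<close>

definition vertex_list :: "'a pair_pre_digraph \<Rightarrow> 'a list" where
  "vertex_list G = (SOME vs. distinct vs \<and> set vs = pverts G)"

definition order_of :: "'a pair_pre_digraph \<Rightarrow> nat" where
  "order_of G = card (pverts G)"

definition adjacency_mat :: "'a pair_pre_digraph \<Rightarrow> real mat" where
  "adjacency_mat G = mat (order_of G) (order_of G)
     (\<lambda>(i, j). if (vertex_list G ! i, vertex_list G ! j) \<in> parcs G then 1 else 0)"

text \<open>The diagonal matrix whose entries are a function of the vertex degrees.\<close>

definition degree_fun_mat :: "(nat \<Rightarrow> real) \<Rightarrow> 'a pair_pre_digraph \<Rightarrow> real mat" where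
  "degree_fun_mat f G = mat_diag (order_of G) (\<lambda>i. f (degree_of G (vertex_list G ! i)))"

definition degree_mat :: "'a pair_pre_digraph \<Rightarrow> real mat" where
  "degree_mat G = degree_fun_mat real G"

definition laplacian_mat :: "'a pair_pre_digraph \<Rightarrow> real mat" where
  "laplacian_mat G = degree_mat G - adjacency_mat G"

definition signless_laplacian_mat :: "'a pair_pre_digraph \<Rightarrow> real mat" where
  "signless_laplacian_mat G = degree_mat G + adjacency_mat G"

definition inv_sqrt_degree_mat :: "'a pair_pre_digraph \<Rightarrow> real mat" where
  "inv_sqrt_degree_mat G = degree_fun_mat (\<lambda>d. if d = 0 then 0 else 1 / sqrt (real d)) G"

text \<open>
  \<open>I - D\<^sup>-\<^sup>1\<^sup>/\<^sup>2 A D\<^sup>-\<^sup>1\<^sup>/\<^sup>2\<close>, where the diagonal entries of \<open>I\<close> at isolated vertices are replaced by \<open>0\<close>.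
\<close>

definition normalized_laplacian_mat :: "'a pair_pre_digraph \<Rightarrow> real mat" where
  "normalized_laplacian_mat G =
     degree_fun_mat (\<lambda>d. if d = 0 then 0 else 1) G
     - inv_sqrt_degree_mat G * adjacency_mat G * inv_sqrt_degree_mat G"

datatype graph_matrix = Adjacency | Laplacian | Signless_Laplacian | Normalized_Laplacian

fun matrix_of :: "graph_matrix \<Rightarrow> 'a pair_pre_digraph \<Rightarrow> real mat" where
  "matrix_of Adjacency G = adjacency_mat G"
| "matrix_of Laplacian G = laplacian_mat G"
| "matrix_of Signless_Laplacian G = signless_laplacian_mat G"
| "matrix_of Normalized_Laplacian G = normalized_laplacian_mat G"

text \<open>
  Eigenvalues with multiplicities. All matrices above are real symmetric, so the real eigenvalues
  are all the eigenvalues, and algebraic and geometric multiplicities agree.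
\<close>

definition eigenvalue_mset :: "real mat \<Rightarrow> real multiset" where
  "eigenvalue_mset M = proots (char_poly M)"

definition cospectral_wrt ::
  "graph_matrix \<Rightarrow> 'a pair_pre_digraph \<Rightarrow> 'b pair_pre_digraph \<Rightarrow> bool" where
  "cospectral_wrt X G H \<longleftrightarrow>
     eigenvalue_mset (matrix_of X G) = eigenvalue_mset (matrix_of X H)"

text \<open>
  Only used for regular graphs, for which cospectrality with respect to one of the four matrices
  implies cospectrality with respect to the others.
\<close>

definition cospectral :: "'a pair_pre_digraph \<Rightarrow> 'b pair_pre_digraph \<Rightarrow> bool" where
  "cospectral G H \<longleftrightarrow> (\<exists>X. cospectral_wrt X G H)"

definition NICS ::
  "graph_matrix set \<Rightarrow> 'a pair_pre_digraph \<Rightarrow> 'b pair_pre_digraph \<Rightarrow> bool" where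
  "NICS S G H \<longleftrightarrow> \<not> isomorphic G H \<and> (\<forall>X \<in> S. cospectral_wrt X G H)"

text \<open>The sum type makes the vertex sets of the two graphs disjoint.\<close>

definition graph_join ::
  "'a pair_pre_digraph \<Rightarrow> 'b pair_pre_digraph \<Rightarrow> ('a + 'b) pair_pre_digraph" where
  "graph_join G1 G2 = \<lparr>
     pverts = pverts G1 <+> pverts G2,
     parcs = {(Inl u, Inl v) | u v. (u, v) \<in> parcs G1}
           \<union> {(Inr u, Inr v) | u v. (u, v) \<in> parcs G2}
           \<union> {(Inl u, Inr v) | u v. u \<in> pverts G1 \<and> v \<in> pverts G2}
           \<union> {(Inr v, Inl u) | u v. u \<in> pverts G1 \<and> v \<in> pverts G2} \<rparr>"

text \<open>
  A vertex \<open>x\<close> of the join becomes \<open>Inl x\<close>; the new vertex \<open>u'\<close> attached to a vertex \<open>u\<close> of the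
  first graph is \<open>Inr u\<close>.
\<close>

definition nns_join ::
  "'a pair_pre_digraph \<Rightarrow> 'b pair_pre_digraph \<Rightarrow> (('a + 'b) + 'a) pair_pre_digraph" where
  "nns_join G1 G2 = \<lparr>
     pverts = pverts (graph_join G1 G2) <+> pverts G1,
     parcs = {(Inl x, Inl y) | x y. (x, y) \<in> parcs (graph_join G1 G2)}
           \<union> {(Inr u, Inl (Inl v)) | u v.
                u \<in> pverts G1 \<and> v \<in> pverts G1 \<and> u \<noteq> v \<and> (u, v) \<notin> parcs G1}
           \<union> {(Inl (Inl v), Inr u) | u v.
                u \<in> pverts G1 \<and> v \<in> pverts G1 \<and> u \<noteq> v \<and> (u, v) \<notin> parcs G1} \<rparr>"

lemma pair_graphI:
  assumes "finite (pverts G)" "parcs G \<subseteq> pverts G \<times> pverts G"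
    "sym (parcs G)" "irrefl (parcs G)"
  shows "pair_graph G"
proof -
  have "finite (parcs G)"
    using assms(1,2) by (meson finite_SigmaI finite_subset)
  then show ?thesis
    using assms by unfold_locales (auto simp: symmetric_def irrefl_def)
qed

lemma pair_graphD:
  assumes "pair_graph G"
  shows "finite (pverts G)" "parcs G \<subseteq> pverts G \<times> pverts G" "sym (parcs G)" "irrefl (parcs G)"
proof -
  interpret pair_graph G by fact
  show "finite (pverts G)" by simp
  show "parcs G \<subseteq> pverts G \<times> pverts G" by (auto dest: in_arcsD1 in_arcsD2)
  show "sym (parcs G)" by (auto intro!: symI dest: arcs_symmetric)
  show "irrefl (parcs G)" by (auto simp: irrefl_def dest: no_loops')
qed

lemma pair_graph_graph_join:
  assumes "pair_graph G1" "pair_graph G2"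
  shows "pair_graph (graph_join G1 G2)"
proof (rule pair_graphI)
  note G1 = pair_graphD[OF assms(1)] and G2 = pair_graphD[OF assms(2)]
  show "finite (pverts (graph_join G1 G2))"
    using G1(1) G2(1) by (simp add: graph_join_def)
  show "parcs (graph_join G1 G2) \<subseteq> pverts (graph_join G1 G2) \<times> pverts (graph_join G1 G2)"
    using G1(2) G2(2) by (auto simp: graph_join_def)
  show "sym (parcs (graph_join G1 G2))"
    using G1(3) G2(3) by (intro symI) (auto simp: graph_join_def dest: symD)
  show "irrefl (parcs (graph_join G1 G2))"
    using G1(4) G2(4) by (auto simp: graph_join_def irrefl_def)
qed

lemma pair_graph_nns_join:
  assumes "pair_graph G1" "pair_graph G2"
  shows "pair_graph (nns_join G1 G2)"
proof (rule pair_graphI)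
  note G1 = pair_graphD[OF assms(1)] and J = pair_graphD[OF pair_graph_graph_join[OF assms]]
  have V: "Inl v \<in> pverts (graph_join G1 G2)" if "v \<in> pverts G1" for v
    using that by (auto simp: graph_join_def)
  show "finite (pverts (nns_join G1 G2))"
    using G1(1) J(1) by (simp add: nns_join_def)
  show "parcs (nns_join G1 G2) \<subseteq> pverts (nns_join G1 G2) \<times> pverts (nns_join G1 G2)"
    using J(2) V by (auto simp: nns_join_def)
  show "sym (parcs (nns_join G1 G2))"
    using J(3) by (intro symI) (auto simp: nns_join_def dest: symD)
  show "irrefl (parcs (nns_join G1 G2))"
    using J(4) by (auto simp: nns_join_def irrefl_def)
qed

end

theory Submission
  imports Defs
begin

text \<open>
  Two real symmetric matrices with the same spectrum are orthogonally similar, and the similarity can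
  be chosen to map a prescribed unit eigenvector to a prescribed one with the same eigenvalue. For
  cospectral \<open>r\<close>-regular graphs this yields an orthogonal matrix that intertwines the adjacency
  matrices and fixes the all-ones vector; that the degrees agree is read off the Frobenius norm.
  If \<open>P\<close> and \<open>Q\<close> are such matrices for \<open>(G1, H1)\<close> and \<open>(G2, H2)\<close>, the block diagonal matrix
  \<open>P \<oplus> Q \<oplus> P\<close> intertwines the adjacency matrices of the two NNS joins. It only relates vertices of
  equal degree, so it intertwines the other three matrices as well. Finally, degrees tell the
  vertices of \<open>G2\<close> apart in the NNS join unless \<open>G2\<close> is complete, so an isomorphism of NNS joins
  restricts to one between \<open>G2\<close> and \<open>H2\<close>.
\<close>

section \<open>Orthogonal similarity of real symmetric matrices\<close>

definition orth_mat :: "nat \<Rightarrow> real mat \<Rightarrow> bool" where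
  "orth_mat n P \<longleftrightarrow> P \<in> carrier_mat n n \<and> transpose_mat P * P = 1\<^sub>m n"

lemma orth_matD:
  assumes "orth_mat n P"
  shows "P \<in> carrier_mat n n" "transpose_mat P * P = 1\<^sub>m n" "P * transpose_mat P = 1\<^sub>m n"
proof -
  show P: "P \<in> carrier_mat n n" and eq: "transpose_mat P * P = 1\<^sub>m n"
    using assms by (simp_all add: orth_mat_def)
  show "P * transpose_mat P = 1\<^sub>m n"
    by (rule mat_mult_left_right_inverse[OF _ P eq]) (use P in simp)
qed

lemma orth_mat_transpose:
  assumes "orth_mat n P"
  shows "orth_mat n (transpose_mat P)"
  unfolding orth_mat_def using orth_matD(1,3)[OF assms] by simp

lemma orth_mat_mult:
  assumes P: "orth_mat n P" and Q: "orth_mat n Q"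
  shows "orth_mat n (P * Q)"
proof -
  note p = orth_matD[OF P] and q = orth_matD[OF Q]
  have "transpose_mat (P * Q) * (P * Q) = transpose_mat Q * ((transpose_mat P * P) * Q)"
    using p(1) q(1) by (simp add: transpose_mult[of _ n n] assoc_mult_mat[of _ n n _ n _ n])
  then show ?thesis
    using p q by (simp add: orth_mat_def)
qed

lemma householder:
  fixes v :: "real vec"
  assumes v: "v \<in> carrier_vec n" and n: "n > 0" and unit: "v \<bullet> v = 1"
  shows "\<exists>S. orth_mat n S \<and> S *\<^sub>v unit_vec n 0 = v"
proof (cases "v = unit_vec n 0")
  case True
  then show ?thesis
    by (intro exI[of _ "1\<^sub>m n"]) (auto simp: orth_mat_def)
next
  case False
  \<comment> \<open>Householder reflection \<open>S = I - c w w^T\<close> along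
    \<open>w = v - e_0\<close>, with \<open>W\<close> the squared length of \<open>w\<close> and
    \<open>c = 2 / W\<close>. It degenerates for \<open>v = e_0\<close>, hence the separate first
    case.\<close>
  define w where "w i = v $ i - (if i = 0 then 1 else 0)" for i
  define W where "W = (\<Sum>i<n. w i * w i)"
  define c where "c = 2 / W"
  have vv: "(\<Sum>i<n. v $ i * v $ i) = 1"
    using unit v by (auto simp: scalar_prod_def atLeast0LessThan)
  have "W = (\<Sum>i<n. v $ i * v $ i + (if i = 0 then 1 - 2 * v $ i else 0))"
    unfolding W_def w_def by (intro sum.cong) (auto simp: algebra_simps)
  also have "\<dots> = 2 - 2 * v $ 0"
    using n vv by (simp add: sum.distrib)
  \<comment> \<open>Because \<open>v\<close> and \<open>e_0\<close> both have length 1,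
    \<open>W\<close> is linear in \<open>v_0\<close>. This yields \<open>c * w 0 = - 1\<close>, and
    so \<open>S e_0 = e_0 + w = v\<close>.\<close>
  finally have W: "W = - 2 * w 0"
    by (simp add: w_def)
  have "\<exists>i<n. w i \<noteq> 0"
  proof (rule ccontr)
    assume "\<not> ?thesis"
    then have "v = unit_vec n 0"
      using v by (intro eq_vecI) (auto simp: w_def unit_vec_def)
    with False show False by simp
  qed
  then obtain i where i: "i < n" "w i \<noteq> 0" by auto
  have "w i * w i \<le> W"
    unfolding W_def using i by (intro member_le_sum) auto
  with i have Wpos: "W > 0"
    by (smt (verit) not_real_square_gt_zero)
  have cW: "c * W = 2" and c0: "c * w 0 = - 1"
    using Wpos W by (auto simp: c_def field_simps)
  define S where "S = mat n n (\<lambda>(i, j). (if i = j then 1 else 0) - c * w i * w j)"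
  have S: "S \<in> carrier_mat n n" by (simp add: S_def)
  have "transpose_mat S * S = 1\<^sub>m n"
  proof (rule eq_matI)
    fix i j assume "i < dim_row (1\<^sub>m n :: real mat)" "j < dim_col (1\<^sub>m n :: real mat)"
    then have ij: "i < n" "j < n" by auto
    have "(transpose_mat S * S) $$ (i, j)
        = (\<Sum>k<n. ((if k = i then 1 else 0) - c * w k * w i) * ((if k = j then 1 else 0) - c * w k * w j))"
      using ij by (simp add: S_def scalar_prod_def atLeast0LessThan)
    also have "\<dots> = (\<Sum>k<n. (if k = i then (if k = j then 1 else 0) - c * w k * w j else 0)
        - (if k = j then c * w k * w i else 0) + c * c * w i * w j * (w k * w k))"
      by (intro sum.cong) (auto simp: algebra_simps)
    also have "\<dots> = (if i = j then 1 else 0) - 2 * (c * w i * w j) + c * w i * w j * (c * W)"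
      using ij by (simp add: sum.distrib sum_subtractf W_def flip: sum_distrib_left)
    finally show "(transpose_mat S * S) $$ (i, j) = 1\<^sub>m n $$ (i, j)"
      using ij cW by simp
  qed (simp_all add: S_def)
  moreover have "S *\<^sub>v unit_vec n 0 = v"
  proof (rule eq_vecI)
    fix i assume "i < dim_vec v"
    then have i: "i < n" using v by auto
    have "(S *\<^sub>v unit_vec n 0) $ i = (if i = 0 then 1 else 0) - c * w i * w 0"
      using i n by (simp add: S_def scalar_prod_right_unit)
    also have "c * w i * w 0 = (c * w 0) * w i" by simp
    finally show "(S *\<^sub>v unit_vec n 0) $ i = v $ i"
      unfolding c0 by (simp add: w_def)
  qed (use v in \<open>simp add: S_def\<close>)
  ultimately show ?thesis
    using S by (auto simp: orth_mat_def)
qed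

section \<open>Eigenvalues and deflation of real symmetric matrices\<close>

lemma symmetric_mat_scalar_prod:
  fixes A :: "'a :: comm_ring_1 mat"
  assumes "A \<in> carrier_mat n n" "transpose_mat A = A" "v \<in> carrier_vec n" "w \<in> carrier_vec n"
  shows "(A *\<^sub>v v) \<bullet> w = v \<bullet> (A *\<^sub>v w)"
  using transpose_vec_mult_scalar[of A n n w v] assms
  by (metis comm_scalar_prod mult_mat_vec_carrier)

lemma eigenvalue_unit_vec:
  fixes A :: "real mat"
  assumes A: "A \<in> carrier_mat n n" and root: "poly (char_poly A) l = 0"
  shows "\<exists>v \<in> carrier_vec n. v \<bullet> v = 1 \<and> A *\<^sub>v v = l \<cdot>\<^sub>v v"
proof -
  obtain u where u: "u \<in> carrier_vec n" "u \<noteq> 0\<^sub>v n" "A *\<^sub>v u = l \<cdot>\<^sub>v u"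
    using root eigenvalue_root_char_poly[OF A] A
    by (auto simp: eigenvalue_def eigenvector_def)
  have pos: "u \<bullet> u > 0"
    using u conjugate_square_greater_0_vec[of u n] by simp
  let ?v = "(1 / sqrt (u \<bullet> u)) \<cdot>\<^sub>v u"
  have "?v \<bullet> ?v = 1"
  proof -
    have "?v \<bullet> ?v = (1 / sqrt (u \<bullet> u)) * (1 / sqrt (u \<bullet> u)) * (u \<bullet> u)"
      using u(1) by (simp add: mult.assoc)
    then show ?thesis using pos by (simp add: divide_simps)
  qed
  moreover have "A *\<^sub>v ?v = l \<cdot>\<^sub>v ?v"
    using u A by (simp add: mult_mat_vec smult_smult_assoc mult.commute)
  ultimately show ?thesis using u(1) by (intro bexI[of _ ?v]) auto
qed

text \<open>The fundamental theorem of algebra gives a complex eigenvalue \<open>z\<close> with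
  eigenvector \<open>x + i y\<close>. Comparing \<open>(A x) y\<close> with \<open>x (A y)\<close>
  gives \<open>Im z * (x x + y y) = 0\<close>, so \<open>z\<close> is real.\<close>

lemma symmetric_real_mat_root:
  fixes A :: "real mat"
  assumes A: "A \<in> carrier_mat n n" and sym: "transpose_mat A = A" and n: "n > 0"
  shows "\<exists>l. poly (char_poly A) l = 0"
proof -
  let ?C = "map_mat complex_of_real A"
  have C: "?C \<in> carrier_mat n n" using A by simp
  have "degree (char_poly ?C) = n"
    using degree_monic_char_poly[OF C] by simp
  then obtain z where "poly (char_poly ?C) z = 0"
    using n fundamental_theorem_of_algebra[of "char_poly ?C"]
    by (auto simp: constant_degree)
  then obtain u where u: "u \<in> carrier_vec n" "u \<noteq> 0\<^sub>v n" "?C *\<^sub>v u = z \<cdot>\<^sub>v u"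
    using eigenvalue_root_char_poly[OF C] A
    by (auto simp: eigenvalue_def eigenvector_def)
  define x where "x = map_vec Re u"
  define y where "y = map_vec Im u"
  have xy: "x \<in> carrier_vec n" "y \<in> carrier_vec n"
    using u(1) by (auto simp: x_def y_def)
  have row: "(\<Sum>j<n. complex_of_real (A $$ (i, j)) * u $ j) = z * u $ i" if "i < n" for i
    using arg_cong[OF u(3), of "\<lambda>v. v $ i"] that A u(1)
    by (simp add: scalar_prod_def atLeast0LessThan)
  have Ax: "A *\<^sub>v x = Re z \<cdot>\<^sub>v x - Im z \<cdot>\<^sub>v y"
  proof (rule eq_vecI)
    fix i assume "i < dim_vec (Re z \<cdot>\<^sub>v x - Im z \<cdot>\<^sub>v y)"
    then have i: "i < n" using xy by simp
    show "(A *\<^sub>v x) $ i = (Re z \<cdot>\<^sub>v x - Im z \<cdot>\<^sub>v y) $ i"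
      using arg_cong[OF row[OF i], of Re] i A u(1) xy
      by (simp add: scalar_prod_def atLeast0LessThan x_def y_def)
  qed (use A xy in auto)
  have Ay: "A *\<^sub>v y = Re z \<cdot>\<^sub>v y + Im z \<cdot>\<^sub>v x"
  proof (rule eq_vecI)
    fix i assume "i < dim_vec (Re z \<cdot>\<^sub>v y + Im z \<cdot>\<^sub>v x)"
    then have i: "i < n" using xy by simp
    show "(A *\<^sub>v y) $ i = (Re z \<cdot>\<^sub>v y + Im z \<cdot>\<^sub>v x) $ i"
      using arg_cong[OF row[OF i], of Im] i A u(1) xy
      by (simp add: scalar_prod_def atLeast0LessThan x_def y_def)
  qed (use A xy in auto)
  have "(A *\<^sub>v x) \<bullet> y = x \<bullet> (A *\<^sub>v y)"
    using symmetric_mat_scalar_prod[OF A sym xy] .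
  then have "Im z * (x \<bullet> x + y \<bullet> y) = 0"
    using xy unfolding Ax Ay
    by (simp add: minus_scalar_prod_distrib[of _ n] scalar_prod_add_distrib[of _ n] algebra_simps)
  moreover have "x \<bullet> x + y \<bullet> y > 0"
  proof -
    have "x \<noteq> 0\<^sub>v n \<or> y \<noteq> 0\<^sub>v n"
    proof (rule ccontr)
      assume "\<not> ?thesis"
      then have xy0: "x = 0\<^sub>v n" "y = 0\<^sub>v n" by auto
      have "u = 0\<^sub>v n"
      proof (rule eq_vecI)
        fix i assume "i < dim_vec (0\<^sub>v n :: complex vec)"
        then have i: "i < n" by simp
        show "u $ i = 0\<^sub>v n $ i"
          using arg_cong[OF xy0(1), of "\<lambda>v. v $ i"] arg_cong[OF xy0(2), of "\<lambda>v. v $ i"] i u(1)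
          by (simp add: x_def y_def complex_eq_iff)
      qed (use u(1) in auto)
      with u(2) show False by simp
    qed
    then show ?thesis
      using conjugate_square_greater_0_vec[OF xy(1)] conjugate_square_greater_0_vec[OF xy(2)]
        conjugate_square_ge_0_vec[of x] conjugate_square_ge_0_vec[of y]
      by (auto simp: add_pos_nonneg add_nonneg_pos)
  qed
  ultimately have Im: "Im z = 0" by simp
  then have z: "z = complex_of_real (Re z)" by (simp add: complex_eq_iff)
  \<comment> \<open>The characteristic polynomial commutes with the embedding of the reals, so the
    real root of the complexified polynomial is a root of the original one.\<close>
  have "poly (map_poly complex_of_real (char_poly A)) (complex_of_real (Re z)) = 0"
    using \<open>poly (char_poly ?C) z = 0\<close> z of_real_hom.char_poly_hom[OF A] by metis
  then have "poly (char_poly A) (Re z) = 0"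
    by simp
  then show ?thesis ..
qed

text \<open>In coordinates where \<open>v\<close> is the first basis vector, the eigenvector
  equation clears the first column below \<open>l\<close> and symmetry clears the first row. What
  remains is a symmetric block one size smaller.\<close>

lemma symmetric_mat_deflation:
  fixes A :: "real mat"
  assumes A: "A \<in> carrier_mat (Suc m) (Suc m)" and sym: "transpose_mat A = A"
    and v: "v \<in> carrier_vec (Suc m)" "v \<bullet> v = 1" and Av: "A *\<^sub>v v = l \<cdot>\<^sub>v v"
  obtains S A' where "orth_mat (Suc m) S" "S *\<^sub>v unit_vec (Suc m) 0 = v"
    "A' \<in> carrier_mat m m" "transpose_mat A' = A'"
    "A = S * four_block_mat (mat 1 1 (\<lambda>_. l)) (0\<^sub>m 1 m) (0\<^sub>m m 1) A' * transpose_mat S"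
    "char_poly A = [:- l, 1:] * char_poly A'"
proof -
  let ?n = "Suc m"
  obtain S where S: "orth_mat ?n S" and Sv: "S *\<^sub>v unit_vec ?n 0 = v"
    using householder[OF v(1) _ v(2)] by auto
  note s = orth_matD[OF S]
  have tS: "transpose_mat S \<in> carrier_mat ?n ?n" using s(1) by simp
  define M where "M = transpose_mat S * A * S"
  have M: "M \<in> carrier_mat ?n ?n" using s(1) A by (simp add: M_def)
  have "transpose_mat M = transpose_mat S * (transpose_mat A * S)"
    unfolding M_def using s(1) A tS
    by (simp add: transpose_mult[of _ ?n ?n _ ?n] assoc_mult_mat[of _ ?n ?n _ ?n _ ?n])
  then have Msym: "transpose_mat M = M"
    unfolding sym M_def using s(1) A tS by (simp add: assoc_mult_mat[of _ ?n ?n _ ?n _ ?n])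
  have "M *\<^sub>v unit_vec ?n 0 = transpose_mat S *\<^sub>v (A *\<^sub>v (S *\<^sub>v unit_vec ?n 0))"
    unfolding M_def using s(1) A tS
    by (simp add: assoc_mult_mat_vec[of _ ?n ?n _ ?n])
  also have "\<dots> = l \<cdot>\<^sub>v (transpose_mat S *\<^sub>v (S *\<^sub>v unit_vec ?n 0))"
    unfolding Sv Av using tS v by (simp add: mult_mat_vec)
  also have "transpose_mat S *\<^sub>v (S *\<^sub>v unit_vec ?n 0) = unit_vec ?n 0"
    using s(1,2) tS by (simp flip: assoc_mult_mat_vec[of _ ?n ?n _ ?n])
  finally have Me: "M *\<^sub>v unit_vec ?n 0 = l \<cdot>\<^sub>v unit_vec ?n 0" .
  have col0: "M $$ (i, 0) = (if i = 0 then l else 0)" if "i < ?n" for i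
    using arg_cong[OF Me, of "\<lambda>w. w $ i"] that M by (simp add: scalar_prod_right_unit)
  have row0: "M $$ (0, i) = (if i = 0 then l else 0)" if "i < ?n" for i
    using col0[OF that] that M arg_cong[OF Msym, of "\<lambda>X. X $$ (0, i)"] by simp
  define A' where "A' = mat m m (\<lambda>(i, j). M $$ (Suc i, Suc j))"
  let ?D = "four_block_mat (mat 1 1 (\<lambda>_. l)) (0\<^sub>m 1 m) (0\<^sub>m m 1) A'"
  have A': "A' \<in> carrier_mat m m" by (simp add: A'_def)
  have MD: "M = ?D"
  proof (rule eq_matI)
    fix i j assume "i < dim_row ?D" "j < dim_col ?D"
    then have "i < ?n" "j < ?n" by (simp_all add: A'_def)
    then show "M $$ (i, j) = ?D $$ (i, j)"
      using col0[of i] row0[of j] by (cases i; cases j) (simp_all add: A'_def)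
  qed (use M in \<open>simp_all add: A'_def\<close>)
  have "transpose_mat A' = A'"
  proof (rule eq_matI)
    fix i j assume "i < dim_row A'" "j < dim_col A'"
    then show "transpose_mat A' $$ (i, j) = A' $$ (i, j)"
      using M arg_cong[OF Msym, of "\<lambda>X. X $$ (Suc i, Suc j)"] by (simp add: A'_def)
  qed (simp_all add: A'_def)
  moreover have "S * M * transpose_mat S = (S * transpose_mat S) * A * (S * transpose_mat S)"
    unfolding M_def using s(1) tS A by (simp add: assoc_mult_mat[of _ ?n ?n _ ?n _ ?n])
  then have AD: "A = S * ?D * transpose_mat S"
    unfolding MD s(3) using A by simp
  moreover have "char_poly A = [:- l, 1:] * char_poly A'"
  proof -
    have "similar_mat A ?D"
      unfolding similar_mat_def similar_mat_wit_def
      using AD s tS A M unfolding MD by (intro exI[of _ S] exI[of _ "transpose_mat S"]) (simp add: Let_def)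
    then have "char_poly A = char_poly ?D" by (rule char_poly_similar)
    also have "\<dots> = char_poly (mat 1 1 (\<lambda>_. l)) * char_poly A'"
      by (rule char_poly_four_block_zeros_col) (use A' in auto)
    also have "char_poly (mat 1 1 (\<lambda>_. l)) = [:- l, 1:]"
      by (simp add: char_poly_defs det_single)
    finally show ?thesis .
  qed
  ultimately show thesis
    using that[OF S Sv A'] by blast
qed

text \<open>Each deflation splits off one real linear factor.\<close>

lemma symmetric_real_char_poly_splits:
  fixes A :: "real mat"
  assumes "A \<in> carrier_mat n n" "transpose_mat A = A"
  shows "char_poly A = (\<Prod>x\<in>#proots (char_poly A). [:- x, 1:])"
  using assms
proof (induction n arbitrary: A)
  case 0
  then have "char_poly A = 1"
    using degree_monic_char_poly[OF 0(1)] monic_degree_0[of "char_poly A"] by simp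
  then show ?case by simp
next
  case (Suc m)
  obtain l where "poly (char_poly A) l = 0"
    using symmetric_real_mat_root[OF Suc.prems] by auto
  then obtain v where "v \<in> carrier_vec (Suc m)" "v \<bullet> v = 1" "A *\<^sub>v v = l \<cdot>\<^sub>v v"
    using eigenvalue_unit_vec[OF Suc.prems(1)] by blast
  then obtain S A' where A': "A' \<in> carrier_mat m m" "transpose_mat A' = A'"
    "char_poly A = [:- l, 1:] * char_poly A'"
    using symmetric_mat_deflation[OF Suc.prems] by blast
  have "char_poly A' \<noteq> 0"
    using degree_monic_char_poly[OF A'(1)] by auto
  then have "proots (char_poly A) = add_mset l (proots (char_poly A'))"
    unfolding A'(3) by (subst proots_mult) auto
  then have "(\<Prod>x\<in>#proots (char_poly A). [:- x, 1:])
      = [:- l, 1:] * (\<Prod>x\<in>#proots (char_poly A'). [:- x, 1:])"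
    by simp
  also have "\<dots> = char_poly A"
    by (simp only: A'(3) Suc.IH[OF A'(1,2), symmetric])
  finally show ?case ..
qed

text \<open>\<open>proots\<close> records real roots only. They determine a monic polynomial once it
  splits over the reals, as it does for symmetric matrices.\<close>

lemma eigenvalue_mset_eq_iff_char_poly_eq:
  assumes "A \<in> carrier_mat n n" "transpose_mat A = A" "B \<in> carrier_mat m m" "transpose_mat B = B"
  shows "eigenvalue_mset A = eigenvalue_mset B \<longleftrightarrow> char_poly A = char_poly B"
proof
  assume "eigenvalue_mset A = eigenvalue_mset B"
  then have eq: "proots (char_poly A) = proots (char_poly B)"
    by (simp only: eigenvalue_mset_def)
  show "char_poly A = char_poly B"
    using symmetric_real_char_poly_splits[OF assms(1,2)] unfolding eq
    by (rule trans) (rule symmetric_real_char_poly_splits[OF assms(3,4), symmetric])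
qed (simp only: eigenvalue_mset_def)

section \<open>Orthogonal similarity from equal characteristic polynomials\<close>

text \<open>Carries an intertwiner of the deflated forms \<open>D\<close> and \<open>E\<close> back
  to the original coordinates: the inner factors \<open>S^T S\<close> and \<open>T^T T\<close>
  cancel.\<close>

lemma orth_conjugate_intertwine:
  assumes S: "orth_mat n S" and T: "orth_mat n T"
    and c: "U \<in> carrier_mat n n" "D \<in> carrier_mat n n" "E \<in> carrier_mat n n"
    and UD: "U * D = E * U"
  shows "T * U * transpose_mat S * (S * D * transpose_mat S)
    = T * E * transpose_mat T * (T * U * transpose_mat S)"
proof -
  note s = orth_matD[OF S] and t = orth_matD[OF T]
  note assoc = assoc_mult_mat[of _ n n _ n _ n]
  have c': "transpose_mat S \<in> carrier_mat n n" "transpose_mat T \<in> carrier_mat n n"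
    using s(1) t(1) by simp_all
  have "T * U * transpose_mat S * (S * D * transpose_mat S)
      = T * U * (transpose_mat S * S) * D * transpose_mat S"
    using s(1) t(1) c c' by (simp add: assoc)
  also have "\<dots> = T * (U * D) * transpose_mat S"
    unfolding s(2) using s(1) t(1) c c' by (simp add: assoc left_mult_one_mat[of _ n n])
  also have "\<dots> = T * E * (transpose_mat T * T) * U * transpose_mat S"
    unfolding t(2) UD using s(1) t(1) c c' by (simp add: assoc left_mult_one_mat[of _ n n])
  also have "\<dots> = T * E * transpose_mat T * (T * U * transpose_mat S)"
    using s(1) t(1) c c' by (simp add: assoc)
  finally show ?thesis .
qed

lemma matching_unit_eigenvectors:
  fixes A B :: "real mat"
  assumes "A \<in> carrier_mat n n" "transpose_mat A = A" "B \<in> carrier_mat n n"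
    and "char_poly A = char_poly B" "n > 0"
  obtains l v w where "v \<in> carrier_vec n" "v \<bullet> v = 1" "A *\<^sub>v v = l \<cdot>\<^sub>v v"
    "w \<in> carrier_vec n" "w \<bullet> w = 1" "B *\<^sub>v w = l \<cdot>\<^sub>v w"
proof -
  obtain l where "poly (char_poly A) l = 0" "poly (char_poly B) l = 0"
    using symmetric_real_mat_root[OF assms(1,2,5)] assms(4) by auto
  then show thesis
    using eigenvalue_unit_vec[OF assms(1)] eigenvalue_unit_vec[OF assms(3)] that by blast
qed

text \<open>
  Deflating both matrices at once, the induction matches the remaining eigenvectors one by one, so
  that no separate diagonalization is needed.
\<close>

lemma symmetric_mats_orth_similar:
  fixes A B :: "real mat"
  assumes "A \<in> carrier_mat n n" "transpose_mat A = A" "B \<in> carrier_mat n n" "transpose_mat B = B"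
    and "char_poly A = char_poly B"
    and "v \<in> carrier_vec n" "v \<bullet> v = 1" "A *\<^sub>v v = l \<cdot>\<^sub>v v"
    and "w \<in> carrier_vec n" "w \<bullet> w = 1" "B *\<^sub>v w = l \<cdot>\<^sub>v w"
  shows "\<exists>P. orth_mat n P \<and> P * A = B * P \<and> P *\<^sub>v v = w"
  using assms
proof (induction n arbitrary: A B v w l)
  case 0
  \<comment> \<open>Dimension 0 has no unit vector, so the premises are contradictory.\<close>
  then show ?case by (simp add: scalar_prod_def)
next
  case (Suc m)
  let ?n = "Suc m"
  obtain S A' where S: "orth_mat ?n S" and Sv: "S *\<^sub>v unit_vec ?n 0 = v"
    and A': "A' \<in> carrier_mat m m" "transpose_mat A' = A'"
    and A_eq: "A = S * four_block_mat (mat 1 1 (\<lambda>_. l)) (0\<^sub>m 1 m) (0\<^sub>m m 1) A' * transpose_mat S"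
    and cA: "char_poly A = [:- l, 1:] * char_poly A'"
    using symmetric_mat_deflation[OF Suc.prems(1,2,6,7,8)] .
  obtain T B' where T: "orth_mat ?n T" and Tw: "T *\<^sub>v unit_vec ?n 0 = w"
    and B': "B' \<in> carrier_mat m m" "transpose_mat B' = B'"
    and B_eq: "B = T * four_block_mat (mat 1 1 (\<lambda>_. l)) (0\<^sub>m 1 m) (0\<^sub>m m 1) B' * transpose_mat T"
    and cB: "char_poly B = [:- l, 1:] * char_poly B'"
    using symmetric_mat_deflation[OF Suc.prems(3,4,9,10,11)] .
  \<comment> \<open>Both matrices were deflated at the same eigenvalue \<open>l\<close>, so the
    linear factor cancels.\<close>
  have char: "char_poly A' = char_poly B'"
    using Suc.prems(5) unfolding cA cB by (simp del: mult_pCons_left)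
  have "\<exists>P. orth_mat m P \<and> P * A' = B' * P"
  \<comment> \<open>The induction hypothesis asks for a pair of unit eigenvectors. Any pair with a
    common eigenvalue will do, but for \<open>m = 0\<close> none exists.\<close>
  proof (cases "m = 0")
    case True
    then show ?thesis
      using A' B' by (intro exI[of _ "1\<^sub>m 0"]) (auto simp: orth_mat_def)
  next
    case False
    then show ?thesis
      using matching_unit_eigenvectors[OF A' B'(1) char] Suc.IH[OF A' B' char] by (metis gr0I)
  qed
  then obtain P where P: "orth_mat m P" "P * A' = B' * P" by auto
  note p = orth_matD[OF P(1)] and s = orth_matD[OF S] and t = orth_matD[OF T]
  let ?U = "four_block_mat (1\<^sub>m 1) (0\<^sub>m 1 m) (0\<^sub>m m 1) P"
  let ?DA = "four_block_mat (mat 1 1 (\<lambda>_. l)) (0\<^sub>m 1 m) (0\<^sub>m m 1) A'"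
  let ?DB = "four_block_mat (mat 1 1 (\<lambda>_. l)) (0\<^sub>m 1 m) (0\<^sub>m m 1) B'"
  have carr: "?U \<in> carrier_mat ?n ?n" "?DA \<in> carrier_mat ?n ?n" "?DB \<in> carrier_mat ?n ?n"
    "transpose_mat S \<in> carrier_mat ?n ?n" "transpose_mat T \<in> carrier_mat ?n ?n"
    using p(1) A'(1) B'(1) s(1) t(1) by auto
  have "transpose_mat ?U = four_block_mat (1\<^sub>m 1) (0\<^sub>m 1 m) (0\<^sub>m m 1) (transpose_mat P)"
    using p(1) by (subst transpose_four_block_mat) auto
  then have "transpose_mat ?U * ?U
      = four_block_mat (1\<^sub>m 1) (0\<^sub>m 1 m) (0\<^sub>m m 1) (transpose_mat P) * ?U"
    by (rule arg_cong)
  also have "\<dots> = 1\<^sub>m ?n"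
    using p(1,2) by (subst mult_four_block_mat) auto
  finally have U: "orth_mat ?n ?U"
    using carr by (simp add: orth_mat_def)
  have "?U * ?DA = four_block_mat (mat 1 1 (\<lambda>_. l)) (0\<^sub>m 1 m) (0\<^sub>m m 1) (P * A')"
    using p(1) A'(1) by (subst mult_four_block_mat) auto
  also have "\<dots> = ?DB * ?U"
    unfolding P(2) using p(1) B'(1) by (subst mult_four_block_mat) auto
  finally have UD: "?U * ?DA = ?DB * ?U" .
  have Ue: "?U *\<^sub>v unit_vec ?n 0 = unit_vec ?n 0"
    using p(1) by (intro eq_vecI) (auto simp: scalar_prod_right_unit)
  \<comment> \<open>\<open>S^T\<close> sends \<open>v\<close> to \<open>e_0\<close>, the leading
    block 1 of \<open>?U\<close> fixes \<open>e_0\<close>, and \<open>T\<close> sends it to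
    \<open>w\<close>.\<close>
  let ?P = "T * ?U * transpose_mat S"
  have "orth_mat ?n ?P"
    by (intro orth_mat_mult T U orth_mat_transpose S)
  moreover have "?P * A = B * ?P"
    unfolding A_eq B_eq by (rule orth_conjugate_intertwine[OF S T carr(1-3) UD])
  moreover have "?P *\<^sub>v v = w"
  proof -
    have "?P *\<^sub>v v = T *\<^sub>v (?U *\<^sub>v ((transpose_mat S * S) *\<^sub>v unit_vec ?n 0))"
      unfolding Sv[symmetric] using s(1) t(1) carr
      by (simp add: assoc_mult_mat_vec[of _ ?n ?n _ ?n])
    then show ?thesis
      unfolding s(2) using Ue Tw by simp
  qed
  ultimately show ?case by blast
qed

section \<open>Matrices of graphs and intertwiners\<close>

definition adj :: "'a pair_pre_digraph \<Rightarrow> 'a \<Rightarrow> 'a \<Rightarrow> real" where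
  "adj G u v = of_bool ((u, v) \<in> parcs G)"

text \<open>Each of the four matrices is a diagonal part depending on the degree, plus the adjacency
  entry scaled by a factor depending on the degrees of both ends. The two weights isolate these
  dependencies so that one argument serves all four.\<close>

fun diag_weight :: "graph_matrix \<Rightarrow> nat \<Rightarrow> real" where
  "diag_weight Adjacency d = 0"
| "diag_weight Laplacian d = d"
| "diag_weight Signless_Laplacian d = d"
| "diag_weight Normalized_Laplacian d = of_bool (d \<noteq> 0)"

fun arc_weight :: "graph_matrix \<Rightarrow> nat \<Rightarrow> nat \<Rightarrow> real" where
  "arc_weight Adjacency d e = 1"
| "arc_weight Laplacian d e = - 1"
| "arc_weight Signless_Laplacian d e = 1"
| "arc_weight Normalized_Laplacian d e = (if d = 0 \<or> e = 0 then 0 else - 1 / (sqrt d * sqrt e))"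

definition graph_entry :: "graph_matrix \<Rightarrow> 'a pair_pre_digraph \<Rightarrow> 'a \<Rightarrow> 'a \<Rightarrow> real" where
  "graph_entry X G u v = (if u = v then diag_weight X (degree_of G u) else 0)
     + arc_weight X (degree_of G u) (degree_of G v) * adj G u v"

lemma vertex_list:
  assumes "finite (pverts G)"
  shows "distinct (vertex_list G)" "set (vertex_list G) = pverts G"
    "length (vertex_list G) = order_of G"
proof -
  have "distinct (vertex_list G) \<and> set (vertex_list G) = pverts G"
    unfolding vertex_list_def by (rule someI_ex) (use finite_distinct_list[OF assms] in blast)
  then show "distinct (vertex_list G)" and set: "set (vertex_list G) = pverts G"
    by simp_all
  then show "length (vertex_list G) = order_of G"
    using distinct_card[of "vertex_list G"] by (simp add: order_of_def)
qed

lemma vertex_list_nth_eq_iff: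
  assumes "finite (pverts G)" "i < order_of G" "j < order_of G"
  shows "vertex_list G ! i = vertex_list G ! j \<longleftrightarrow> i = j"
  using vertex_list[OF assms(1)] assms(2,3) by (simp add: nth_eq_iff_index_eq)

lemma vertex_list_nth_in:
  assumes "finite (pverts G)" "i < order_of G"
  shows "vertex_list G ! i \<in> pverts G"
  using vertex_list[OF assms(1)] assms(2) nth_mem by metis

lemma sum_vertex_list:
  assumes "finite (pverts G)"
  shows "(\<Sum>i<order_of G. f (vertex_list G ! i)) = (\<Sum>v\<in>pverts G. f v)"
  using vertex_list[OF assms] by (intro sum.reindex_bij_betw bij_betw_nth) auto

lemma matrix_of_eq_graph_entry:
  assumes G: "finite (pverts G)"
  shows "matrix_of X G = mat (order_of G) (order_of G)
    (\<lambda>(i, j). graph_entry X G (vertex_list G ! i) (vertex_list G ! j))"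
proof -
  let ?n = "order_of G" and ?v = "\<lambda>i. vertex_list G ! i"
  have A: "adjacency_mat G = mat ?n ?n (\<lambda>(i, j). adj G (?v i) (?v j))"
    by (auto simp: adjacency_mat_def adj_def)
  have D: "degree_fun_mat f G = mat ?n ?n (\<lambda>(i, j). if ?v i = ?v j then f (degree_of G (?v i)) else 0)" for f
    using vertex_list_nth_eq_iff[OF G] by (auto simp: degree_fun_mat_def mat_diag_def)
  \<comment> \<open>The arc weight already carries the minus sign of
    \<open>I - D^(-1/2) A D^(-1/2)\<close>, so this product is its negative.\<close>
  have "inv_sqrt_degree_mat G * adjacency_mat G * inv_sqrt_degree_mat G = mat ?n ?n
     (\<lambda>(i, j). - arc_weight Normalized_Laplacian (degree_of G (?v i)) (degree_of G (?v j)) * adj G (?v i) (?v j))"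
    unfolding A inv_sqrt_degree_mat_def degree_fun_mat_def
    by (subst mat_diag_mult_left[where nr = ?n], simp, subst mat_diag_mult_right[where nr = ?n], simp)
      (auto simp: field_simps)
  then show ?thesis
    by (cases X) (auto simp: graph_entry_def A D laplacian_mat_def signless_laplacian_mat_def
        normalized_laplacian_mat_def degree_mat_def)
qed

lemma adj_commute:
  assumes "pair_graph G"
  shows "adj G u v = adj G v u"
  using pair_graphD(3)[OF assms] by (auto simp: adj_def dest: symD)

lemma arc_weight_commute: "arc_weight X d e = arc_weight X e d"
  by (cases X) (auto simp: mult.commute)

lemma graph_entry_commute:
  assumes "pair_graph G"
  shows "graph_entry X G u v = graph_entry X G v u"
  using adj_commute[OF assms] arc_weight_commute by (auto simp: graph_entry_def)

lemma matrix_of_symmetric: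
  assumes "pair_graph G"
  shows "matrix_of X G \<in> carrier_mat (order_of G) (order_of G)"
    "transpose_mat (matrix_of X G) = matrix_of X G"
  using graph_entry_commute[OF assms]
  by (auto simp: matrix_of_eq_graph_entry[OF pair_graphD(1)[OF assms]])

lemma cospectral_wrt_iff_char_poly_eq:
  assumes "pair_graph G" "pair_graph H"
  shows "cospectral_wrt X G H \<longleftrightarrow> char_poly (matrix_of X G) = char_poly (matrix_of X H)"
  unfolding cospectral_wrt_def
  by (rule eigenvalue_mset_eq_iff_char_poly_eq[OF matrix_of_symmetric[OF assms(1)] matrix_of_symmetric[OF assms(2)]])

text \<open>The order is the degree of the characteristic polynomial.\<close>

lemma cospectral_wrt_order:
  assumes "pair_graph G" "pair_graph H" "cospectral_wrt X G H"
  shows "order_of G = order_of H"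
  using degree_monic_char_poly[OF matrix_of_symmetric(1)[OF assms(1)]]
    degree_monic_char_poly[OF matrix_of_symmetric(1)[OF assms(2)]]
    cospectral_wrt_iff_char_poly_eq[OF assms(1,2)] assms(3)
  by metis

lemma degree_of_eq_card:
  assumes "pair_graph G"
  shows "degree_of G u = card {v \<in> pverts G. (u, v) \<in> parcs G}"
proof -
  have "out_arcs (with_proj G) u = Pair u ` {v \<in> pverts G. (u, v) \<in> parcs G}"
    using pair_graphD(2)[OF assms] by (auto simp: out_arcs_def)
  then show ?thesis
    by (simp add: degree_of_def out_degree_def card_image inj_on_def)
qed

lemma sum_adj:
  assumes "pair_graph G"
  shows "(\<Sum>v\<in>pverts G. adj G u v) = degree_of G u"
  using pair_graphD(1)[OF assms]
  by (simp add: degree_of_eq_card[OF assms] adj_def sum.If_cases Int_def of_bool_def)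

section \<open>Intertwiners and cospectrality\<close>

text \<open>An orthogonal matrix \<open>P\<close> with \<open>P A(G) = A(H) P\<close>, indexed by
  vertices instead of positions so that blocks of a join can be written down without enumerating its
  vertices.\<close>

definition intertwiner ::
  "'a pair_pre_digraph \<Rightarrow> 'b pair_pre_digraph \<Rightarrow> ('b \<Rightarrow> 'a \<Rightarrow> real) \<Rightarrow> bool" where
  "intertwiner G H p \<longleftrightarrow>
     (\<forall>a\<in>pverts G. \<forall>a'\<in>pverts G. (\<Sum>b\<in>pverts H. p b a * p b a') = of_bool (a = a')) \<and>
     (\<forall>b\<in>pverts H. \<forall>b'\<in>pverts H. (\<Sum>a\<in>pverts G. p b a * p b' a) = of_bool (b = b')) \<and>
     (\<forall>b\<in>pverts H. \<forall>a\<in>pverts G.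
        (\<Sum>a'\<in>pverts G. p b a' * adj G a' a) = (\<Sum>b'\<in>pverts H. adj H b b' * p b' a))"

text \<open>If \<open>p\<close> links only vertices of equal degree, degree-dependent factors can be
  moved across it. It then intertwines all four matrices, and orthogonality turns this into
  similarity.\<close>

lemma intertwiner_degree_imp_cospectral_wrt:
  assumes G: "pair_graph G" and H: "pair_graph H" and ord: "order_of G = order_of H"
    and p: "intertwiner G H p"
    and deg: "\<And>a b. a \<in> pverts G \<Longrightarrow> b \<in> pverts H \<Longrightarrow> p b a \<noteq> 0 \<Longrightarrow> degree_of G a = degree_of H b"
  shows "cospectral_wrt X G H"
proof -
  note fin = pair_graphD(1)[OF G] pair_graphD(1)[OF H]
  let ?n = "order_of G" and ?v = "\<lambda>i. vertex_list G ! i" and ?w = "\<lambda>i. vertex_list H ! i"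
  have in_v: "?v i \<in> pverts G" "?w i \<in> pverts H" if "i < ?n" for i
    using that vertex_list_nth_in[OF fin(1)] vertex_list_nth_in[OF fin(2)] ord by auto
  note sum_v = sum_vertex_list[OF fin(1)] and sum_w = sum_vertex_list[OF fin(2), folded ord]
  have entries: "(\<Sum>a'\<in>pverts G. p b a' * graph_entry X G a' a)
      = (\<Sum>b'\<in>pverts H. graph_entry X H b b' * p b' a)"
    if ab: "a \<in> pverts G" "b \<in> pverts H" for a b
  proof -
    \<comment> \<open>One constant serves both sums: where \<open>p b a'\<close> is nonzero,
      \<open>a'\<close> has the degree of \<open>b\<close>, and where \<open>p b' a\<close> is
      nonzero, \<open>b'\<close> has the degree of \<open>a\<close>.\<close>
    let ?c = "arc_weight X (degree_of H b) (degree_of G a)"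
    have "(\<Sum>a'\<in>pverts G. p b a' * graph_entry X G a' a)
        = (\<Sum>a'\<in>pverts G. (if a' = a then p b a * diag_weight X (degree_of G a) else 0)
            + ?c * (p b a' * adj G a' a))"
    proof (intro sum.cong refl)
      fix a' assume "a' \<in> pverts G"
      then show "p b a' * graph_entry X G a' a
        = (if a' = a then p b a * diag_weight X (degree_of G a) else 0) + ?c * (p b a' * adj G a' a)"
        using deg[OF _ ab(2), of a'] by (cases "p b a' = 0") (auto simp: graph_entry_def algebra_simps)
    qed
    also have "\<dots> = p b a * diag_weight X (degree_of G a) + ?c * (\<Sum>a'\<in>pverts G. p b a' * adj G a' a)"
      using fin ab by (simp add: sum.distrib sum_distrib_left)
    also have "\<dots> = p b a * diag_weight X (degree_of H b) + ?c * (\<Sum>b'\<in>pverts H. adj H b b' * p b' a)"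
      using p ab deg[OF ab] by (cases "p b a = 0") (auto simp: intertwiner_def)
    also have "\<dots> = (\<Sum>b'\<in>pverts H. (if b = b' then p b a * diag_weight X (degree_of H b) else 0)
            + ?c * (adj H b b' * p b' a))"
      using fin ab by (simp add: sum.distrib sum_distrib_left)
    also have "\<dots> = (\<Sum>b'\<in>pverts H. graph_entry X H b b' * p b' a)"
    proof (intro sum.cong refl)
      fix b' assume "b' \<in> pverts H"
      then show "(if b = b' then p b a * diag_weight X (degree_of H b) else 0) + ?c * (adj H b b' * p b' a)
          = graph_entry X H b b' * p b' a"
        using deg[OF ab(1), of b'] by (cases "p b' a = 0") (auto simp: graph_entry_def algebra_simps)
    qed
    finally show ?thesis .
  qed
  define P where "P = mat ?n ?n (\<lambda>(i, j). p (?w i) (?v j))"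
  let ?M = "matrix_of X G" and ?N = "matrix_of X H"
  note M = matrix_of_eq_graph_entry[OF fin(1), of X]
    and N = matrix_of_eq_graph_entry[OF fin(2), of X, folded ord]
  have P: "P \<in> carrier_mat ?n ?n" and tP: "transpose_mat P \<in> carrier_mat ?n ?n"
    by (simp_all add: P_def)
  have Mc: "?M \<in> carrier_mat ?n ?n" "?N \<in> carrier_mat ?n ?n"
    by (simp_all add: M N)
  have PM: "P * ?M = ?N * P"
  proof (rule eq_matI)
    fix i j assume "i < dim_row (?N * P)" "j < dim_col (?N * P)"
    then have ij: "i < ?n" "j < ?n" by (simp_all add: N P_def)
    have "(P * ?M) $$ (i, j) = (\<Sum>k<?n. p (?w i) (?v k) * graph_entry X G (?v k) (?v j))"
      using ij by (simp add: P_def M scalar_prod_def atLeast0LessThan)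
    also have "\<dots> = (\<Sum>k<?n. graph_entry X H (?w i) (?w k) * p (?w k) (?v j))"
      unfolding sum_v[of "\<lambda>a. p (?w i) a * graph_entry X G a (?v j)"]
        sum_w[of "\<lambda>b. graph_entry X H (?w i) b * p b (?v j)"]
      using ij in_v by (intro entries)
    also have "\<dots> = (?N * P) $$ (i, j)"
      using ij by (simp add: P_def N scalar_prod_def atLeast0LessThan)
    finally show "(P * ?M) $$ (i, j) = (?N * P) $$ (i, j)" .
  qed (simp_all add: P_def M N)
  have "P * transpose_mat P = 1\<^sub>m ?n"
  proof (rule eq_matI)
    fix i j assume "i < dim_row (1\<^sub>m ?n :: real mat)" "j < dim_col (1\<^sub>m ?n :: real mat)"
    then have ij: "i < ?n" "j < ?n" by simp_all
    have "(P * transpose_mat P) $$ (i, j) = (\<Sum>k<?n. p (?w i) (?v k) * p (?w j) (?v k))"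
      using ij by (simp add: P_def scalar_prod_def atLeast0LessThan)
    also have "\<dots> = of_bool (?w i = ?w j)"
      unfolding sum_v[of "\<lambda>a. p (?w i) a * p (?w j) a"]
      using p ij in_v by (simp add: intertwiner_def)
    finally show "(P * transpose_mat P) $$ (i, j) = 1\<^sub>m ?n $$ (i, j)"
      using ij vertex_list_nth_eq_iff[OF fin(2), of i j] ord by simp
  qed (simp_all add: P_def)
  then have PP: "P * transpose_mat P = 1\<^sub>m ?n" "transpose_mat P * P = 1\<^sub>m ?n"
    using mat_mult_left_right_inverse[OF P tP] by simp_all
  have "P * ?M * transpose_mat P = ?N * (P * transpose_mat P)"
    unfolding PM using P tP Mc by (intro assoc_mult_mat)
  also have "\<dots> = ?N"
    unfolding PP using Mc by simp
  finally have N_eq: "?N = P * ?M * transpose_mat P" ..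
  have "similar_mat ?N ?M"
    unfolding similar_mat_def
    using similar_mat_witI[OF PP N_eq Mc(2,1) P tP] by blast
  then show ?thesis
    unfolding cospectral_wrt_iff_char_poly_eq[OF G H] by (rule char_poly_similar[symmetric])
qed

section \<open>The degree of a regular graph from its spectrum\<close>

text \<open>An orthogonal matrix preserves the length of every column.\<close>

lemma orth_mat_mult_frobenius:
  assumes P: "orth_mat n P" and M: "M \<in> carrier_mat n n"
  shows "(\<Sum>j<n. \<Sum>i<n. ((P * M) $$ (i, j))\<^sup>2) = (\<Sum>j<n. \<Sum>i<n. (M $$ (i, j))\<^sup>2)"
proof (rule sum.cong[OF refl])
  note p = orth_matD[OF P]
  fix j assume "j \<in> {..<n}"
  then have j: "j < n" by simp
  let ?x = "col M j"
  have x: "?x \<in> carrier_vec n" by (rule carrier_vecI) (use M in simp)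
  have Px: "P *\<^sub>v ?x \<in> carrier_vec n" using p(1) x by simp
  have "(P *\<^sub>v ?x) \<bullet> (P *\<^sub>v ?x) = (transpose_mat P *\<^sub>v (P *\<^sub>v ?x)) \<bullet> ?x"
    using transpose_vec_mult_scalar[OF p(1) x Px] by simp
  also have "transpose_mat P *\<^sub>v (P *\<^sub>v ?x) = ?x"
    using assoc_mult_mat_vec[of "transpose_mat P" n n P n ?x] p x by simp
  finally have Px_x: "(P *\<^sub>v ?x) \<bullet> (P *\<^sub>v ?x) = ?x \<bullet> ?x" .
  have sq: "y \<bullet> y = (\<Sum>i<n. (y $ i)\<^sup>2)" if "y \<in> carrier_vec n" for y :: "real vec"
    using that by (simp add: scalar_prod_def atLeast0LessThan power2_eq_square)
  have "(P * M) $$ (i, j) = (P *\<^sub>v ?x) $ i" "M $$ (i, j) = ?x $ i" if "i < n" for i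
    using that p(1) M j by auto
  then show "(\<Sum>i<n. ((P * M) $$ (i, j))\<^sup>2) = (\<Sum>i<n. (M $$ (i, j))\<^sup>2)"
    using Px_x unfolding sq[OF x] sq[OF Px] by simp
qed

text \<open>Both \<open>P M\<close> and \<open>N P\<close> have the norm of their other factor. For
  multiplication on the right this follows by transposing.\<close>

lemma orth_intertwine_frobenius:
  assumes P: "orth_mat n P" and M: "M \<in> carrier_mat n n" and N: "N \<in> carrier_mat n n"
    and PM: "P * M = N * P"
  shows "(\<Sum>j<n. \<Sum>i<n. (M $$ (i, j))\<^sup>2) = (\<Sum>j<n. \<Sum>i<n. (N $$ (i, j))\<^sup>2)"
proof -
  note p = orth_matD[OF P]
  have "(\<Sum>j<n. \<Sum>i<n. (M $$ (i, j))\<^sup>2) = (\<Sum>j<n. \<Sum>i<n. ((N * P) $$ (i, j))\<^sup>2)"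
    unfolding PM[symmetric] by (rule orth_mat_mult_frobenius[OF P M, symmetric])
  also have "\<dots> = (\<Sum>i<n. \<Sum>j<n. (transpose_mat (N * P) $$ (j, i))\<^sup>2)"
    using N p(1) by (subst sum.swap) simp
  also have "transpose_mat (N * P) = transpose_mat P * transpose_mat N"
    using N p(1) by (rule transpose_mult)
  also have "(\<Sum>i<n. \<Sum>j<n. ((transpose_mat P * transpose_mat N) $$ (j, i))\<^sup>2)
      = (\<Sum>i<n. \<Sum>j<n. (transpose_mat N $$ (j, i))\<^sup>2)"
    using N by (intro orth_mat_mult_frobenius orth_mat_transpose P) simp
  also have "\<dots> = (\<Sum>j<n. \<Sum>i<n. (N $$ (i, j))\<^sup>2)"
    using N by (subst sum.swap) simp
  finally show ?thesis .
qed

lemma graph_entry_regular: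
  assumes "\<And>v. v \<in> pverts G \<Longrightarrow> degree_of G v = r" "u \<in> pverts G" "v \<in> pverts G"
  shows "graph_entry X G u v = (if u = v then diag_weight X r else 0) + arc_weight X r r * adj G u v"
  using assms by (simp add: graph_entry_def)

lemma adj_irrefl:
  assumes "pair_graph G"
  shows "adj G u u = 0"
  using pair_graphD(4)[OF assms] by (auto simp: adj_def irrefl_def)

lemma frobenius_matrix_of_regular:
  assumes G: "pair_graph G" and reg: "\<And>v. v \<in> pverts G \<Longrightarrow> degree_of G v = r"
  shows "(\<Sum>j<order_of G. \<Sum>i<order_of G. (matrix_of X G $$ (i, j))\<^sup>2)
    = order_of G * ((diag_weight X r)\<^sup>2 + (arc_weight X r r)\<^sup>2 * r)"
proof -
  let ?n = "order_of G" and ?v = "\<lambda>i. vertex_list G ! i"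
  note fin = pair_graphD(1)[OF G]
  have "(\<Sum>j<?n. \<Sum>i<?n. (matrix_of X G $$ (i, j))\<^sup>2)
      = (\<Sum>j<?n. \<Sum>i<?n. (graph_entry X G (?v i) (?v j))\<^sup>2)"
    by (simp add: matrix_of_eq_graph_entry[OF fin])
  also have "\<dots> = (\<Sum>v\<in>pverts G. \<Sum>u\<in>pverts G. (graph_entry X G u v)\<^sup>2)"
    by (simp add: sum_vertex_list[OF fin, of "\<lambda>u. (graph_entry X G u _)\<^sup>2"]
        sum_vertex_list[OF fin, of "\<lambda>v. \<Sum>u\<in>pverts G. (graph_entry X G u v)\<^sup>2"])
  also have "\<dots> = (\<Sum>v\<in>pverts G. (diag_weight X r)\<^sup>2 + (arc_weight X r r)\<^sup>2 * r)"
  proof (rule sum.cong[OF refl])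
    fix v assume v: "v \<in> pverts G"
    \<comment> \<open>Without loops the diagonal term and the adjacency term never meet, so squaring
      produces no cross term; \<open>adj\<close> is its own square.\<close>
    have "(\<Sum>u\<in>pverts G. (graph_entry X G u v)\<^sup>2)
        = (\<Sum>u\<in>pverts G. (if u = v then (diag_weight X r)\<^sup>2 else 0) + (arc_weight X r r)\<^sup>2 * adj G v u)"
    proof (intro sum.cong refl)
      fix u assume "u \<in> pverts G"
      then show "(graph_entry X G u v)\<^sup>2
        = (if u = v then (diag_weight X r)\<^sup>2 else 0) + (arc_weight X r r)\<^sup>2 * adj G v u"
        using adj_irrefl[OF G, of v] adj_commute[OF G, of u v] v
        by (simp add: graph_entry_regular[OF reg] power_mult_distrib) (simp add: adj_def)
    qed
    also have "\<dots> = (diag_weight X r)\<^sup>2 + (arc_weight X r r)\<^sup>2 * (\<Sum>u\<in>pverts G. adj G v u)"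
      using fin v by (simp add: sum.distrib sum_distrib_left)
    finally show "(\<Sum>u\<in>pverts G. (graph_entry X G u v)\<^sup>2)
        = (diag_weight X r)\<^sup>2 + (arc_weight X r r)\<^sup>2 * r"
      using reg[OF v] by (simp add: sum_adj[OF G])
  qed
  finally show ?thesis by (simp add: order_of_def)
qed

text \<open>The expression is \<open>r\<close> for the adjacency matrix, \<open>r^2 + r\<close> for
  both Laplacians without normalization, and \<open>1 + 1/r\<close> (0 for \<open>r = 0\<close>) for
  the normalized one. Each is injective in \<open>r\<close>.\<close>

lemma regular_frobenius_inj:
  assumes "(diag_weight X r)\<^sup>2 + (arc_weight X r r)\<^sup>2 * r = (diag_weight X s)\<^sup>2 + (arc_weight X s s)\<^sup>2 * s"
  shows "r = s"
proof -
  have quad: "a = b" if "(real a)\<^sup>2 + a = (real b)\<^sup>2 + b" for a b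
  proof -
    have "a\<^sup>2 + a = b\<^sup>2 + b"
      using that by (metis of_nat_add of_nat_eq_iff of_nat_power)
    then have "a * (a + 1) = b * (b + 1)" by (simp add: power2_eq_square)
    then show ?thesis
      by (metis add_less_mono1 linorder_neqE_nat mult_strict_mono' order_less_irrefl zero_le)
  qed
  have norm: "(of_bool (d \<noteq> 0))\<^sup>2 + (arc_weight Normalized_Laplacian d d)\<^sup>2 * d
      = (if d = 0 then 0 else 1 + 1 / d)" for d
    by (simp add: power_divide power2_eq_square)
  show ?thesis
  proof (cases X)
    case Normalized_Laplacian
    then have "(if r = 0 then 0 else 1 + 1 / real r) = (if s = 0 then 0 else 1 + 1 / real s)"
      using assms norm[of r] norm[of s] by simp
    then show ?thesis
      by (smt (verit) divide_cancel_left of_nat_0_le_iff of_nat_eq_iff zero_le_divide_1_iff)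
  qed (use assms quad in auto)
qed

lemma regular_cospectral_same_degree:
  assumes G: "pair_graph G" and H: "pair_graph H"
    and r: "\<And>v. v \<in> pverts G \<Longrightarrow> degree_of G v = r"
    and s: "\<And>v. v \<in> pverts H \<Longrightarrow> degree_of H v = s"
    and cosp: "cospectral_wrt X G H" and ne: "pverts G \<noteq> {}"
  shows "r = s"
proof -
  let ?n = "order_of G" and ?M = "matrix_of X G" and ?N = "matrix_of X H"
  have ord: "order_of H = ?n"
    using cospectral_wrt_order[OF G H cosp] by simp
  \<comment> \<open>The order has to be cancelled at the end; an empty graph would be regular of
    every degree.\<close>
  have pos: "?n > 0"
    using ne pair_graphD(1)[OF G] by (simp add: order_of_def card_gt_0_iff)
  note M = matrix_of_symmetric[OF G, of X] and N = matrix_of_symmetric[OF H, of X, unfolded ord]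
  have char: "char_poly ?M = char_poly ?N"
    using cosp by (simp only: cospectral_wrt_iff_char_poly_eq[OF G H])
  obtain P where P: "orth_mat ?n P" "P * ?M = ?N * P"
    using matching_unit_eigenvectors[OF M N(1) char pos] symmetric_mats_orth_similar[OF M N char]
    by metis
  have "real ?n * ((diag_weight X r)\<^sup>2 + (arc_weight X r r)\<^sup>2 * r)
      = real ?n * ((diag_weight X s)\<^sup>2 + (arc_weight X s s)\<^sup>2 * s)"
    using orth_intertwine_frobenius[OF P(1) M(1) N(1) P(2)]
      frobenius_matrix_of_regular[OF G r, of X] frobenius_matrix_of_regular[OF H s, of X, unfolded ord]
    by simp
  then show ?thesis
    using pos by (intro regular_frobenius_inj[of X]) simp
qed

section \<open>Intertwiners between cospectral regular graphs\<close>

text \<open>Writing \<open>1\<close> for the all-ones vector, \<open>P 1 = 1\<close> implies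
  \<open>P^T 1 = P^T P 1 = 1\<close>.\<close>

lemma intertwiner_col_sum:
  assumes G: "pair_graph G" and p: "intertwiner G H p"
    and row: "\<And>b. b \<in> pverts H \<Longrightarrow> (\<Sum>a\<in>pverts G. p b a) = 1" and a: "a \<in> pverts G"
  shows "(\<Sum>b\<in>pverts H. p b a) = 1"
proof -
  have "(\<Sum>b\<in>pverts H. p b a) = (\<Sum>b\<in>pverts H. \<Sum>a'\<in>pverts G. p b a * p b a')"
    using row by (intro sum.cong) (simp_all flip: sum_distrib_left)
  also have "\<dots> = (\<Sum>a'\<in>pverts G. of_bool (a = a'))"
    using p a by (subst sum.swap) (simp add: intertwiner_def)
  also have "\<dots> = 1"
    using pair_graphD(1)[OF G] a by simp
  finally show ?thesis .
qed

text \<open>In a regular graph all rows of the matrix have the same sum. The all-ones vector is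
  normalized because the orthogonal similarity prescribes unit eigenvectors.\<close>

lemma matrix_of_regular_unit_eigenvector:
  assumes G: "pair_graph G" and r: "\<And>v. v \<in> pverts G \<Longrightarrow> degree_of G v = r"
    and n: "n = order_of G" "n > 0"
  shows "matrix_of X G *\<^sub>v vec n (\<lambda>_. 1 / sqrt n)
    = (diag_weight X r + arc_weight X r r * r) \<cdot>\<^sub>v vec n (\<lambda>_. 1 / sqrt n)"
proof (rule eq_vecI)
  let ?c = "1 / sqrt n" and ?l = "diag_weight X r + arc_weight X r r * r"
  note fin = pair_graphD(1)[OF G]
  fix i assume "i < dim_vec (?l \<cdot>\<^sub>v vec n (\<lambda>_. ?c))"
  then have i: "i < n" by simp
  let ?u = "vertex_list G ! i"
  have u: "?u \<in> pverts G" using vertex_list_nth_in[OF fin] i n by simp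
  have "(\<Sum>v\<in>pverts G. graph_entry X G ?u v)
      = (\<Sum>v\<in>pverts G. (if v = ?u then diag_weight X r else 0) + arc_weight X r r * adj G ?u v)"
    using u by (intro sum.cong) (auto simp: graph_entry_regular[OF r])
  also have "\<dots> = ?l"
    using fin u r[OF u] by (simp add: sum.distrib sum_adj[OF G] flip: sum_distrib_left)
  finally have row: "(\<Sum>v\<in>pverts G. graph_entry X G ?u v) = ?l" .
  have "(matrix_of X G *\<^sub>v vec n (\<lambda>_. ?c)) $ i
      = (\<Sum>k<n. graph_entry X G ?u (vertex_list G ! k) * ?c)"
    using i n(1) by (simp add: matrix_of_eq_graph_entry[OF fin] scalar_prod_def atLeast0LessThan)
  also have "\<dots> = (\<Sum>v\<in>pverts G. graph_entry X G ?u v) * ?c"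
    unfolding sum_distrib_right n(1) by (rule sum_vertex_list[OF fin])
  finally show "(matrix_of X G *\<^sub>v vec n (\<lambda>_. ?c)) $ i = (?l \<cdot>\<^sub>v vec n (\<lambda>_. ?c)) $ i"
    unfolding row using i by simp
qed (use n matrix_of_symmetric(1)[OF G, of X] in auto)

lemma adj_eq_0_of_degree_0:
  assumes "pair_graph G" "degree_of G u = 0"
  shows "adj G u v = 0"
  using assms pair_graphD(1,2)[OF assms(1)]
  by (auto simp: degree_of_eq_card adj_def)

text \<open>For graphs of common degree \<open>r\<close>, the matrix of either one is the same
  affine combination of the identity and its adjacency matrix, so a similarity for any
  \<open>X\<close> gives one for \<open>A\<close>. The row sum condition says that the all-ones
  vector is fixed.\<close>

lemma regular_cospectral_intertwiner:
  fixes G :: "'a pair_pre_digraph" and H :: "'b pair_pre_digraph"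
  assumes G: "pair_graph G" and H: "pair_graph H"
    and r: "\<And>v. v \<in> pverts G \<Longrightarrow> degree_of G v = r" "\<And>v. v \<in> pverts H \<Longrightarrow> degree_of H v = r"
    and cosp: "cospectral_wrt X G H" and ne: "pverts G \<noteq> {}"
  obtains p where "intertwiner G H p" "\<And>b. b \<in> pverts H \<Longrightarrow> (\<Sum>a\<in>pverts G. p b a) = 1"
proof -
  define n where "n = order_of G"
  let ?M = "matrix_of X G" and ?N = "matrix_of X H"
  let ?v = "\<lambda>i. vertex_list G ! i" and ?w = "\<lambda>i. vertex_list H ! i"
  note fin = pair_graphD(1)[OF G] pair_graphD(1)[OF H]
  have ord: "order_of G = n" "order_of H = n"
    using cospectral_wrt_order[OF G H cosp] by (simp_all add: n_def)
  have pos: "n > 0"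
    using ne fin by (simp add: n_def order_of_def card_gt_0_iff)
  note M = matrix_of_symmetric[OF G, of X, unfolded ord]
    and N = matrix_of_symmetric[OF H, of X, unfolded ord]
  have char: "char_poly ?M = char_poly ?N"
    using cosp by (simp only: cospectral_wrt_iff_char_poly_eq[OF G H])
  let ?e = "vec n (\<lambda>_. 1 / sqrt (real n)) :: real vec"
  have e: "?e \<in> carrier_vec n" by simp
  have ee: "?e \<bullet> ?e = 1"
    using pos by (simp add: scalar_prod_def)
  \<comment> \<open>The normalized all-ones vectors are eigenvectors for the same eigenvalue, as
    both graphs have degree \<open>r\<close>, so they may be prescribed as the matched pair.\<close>
  obtain P where P: "orth_mat n P" and PM: "P * ?M = ?N * P" and Pe: "P *\<^sub>v ?e = ?e"
    using symmetric_mats_orth_similar[OF M N char e ee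
        matrix_of_regular_unit_eigenvector[OF G r(1) ord(1)[symmetric] pos] e ee
        matrix_of_regular_unit_eigenvector[OF H r(2) ord(2)[symmetric] pos]]
    by blast
  note Pc = orth_matD[OF P]
  have index: "?v i = ?v j \<longleftrightarrow> i = j" "?w i = ?w j \<longleftrightarrow> i = j" if "i < n" "j < n" for i j
    using that ord vertex_list_nth_eq_iff[OF fin(1), of i j] vertex_list_nth_eq_iff[OF fin(2), of i j]
    by auto
  \<comment> \<open>The matrix is transported from positions to vertices by inverting the two
    enumerations.\<close>
  define p where "p b a = P $$ (inv_into {..<n} ?w b, inv_into {..<n} ?v a)" for b a
  have "inj_on ?v {..<n}" "inj_on ?w {..<n}"
    using index by (auto simp: inj_on_def)
  then have p_nth: "p (?w i) (?v j) = P $$ (i, j)" if "i < n" "j < n" for i j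
    using that by (simp add: p_def inv_into_f_f)
  have exG: "\<exists>i<n. a = ?v i" if "a \<in> pverts G" for a
    using that vertex_list[OF fin(1)] ord by (metis in_set_conv_nth)
  have exH: "\<exists>i<n. b = ?w i" if "b \<in> pverts H" for b
    using that vertex_list[OF fin(2)] ord by (metis in_set_conv_nth)
  have sumG: "(\<Sum>a\<in>pverts G. f a) = (\<Sum>i<n. f (?v i))" for f :: "'a \<Rightarrow> real"
    using sum_vertex_list[OF fin(1), of f] ord by simp
  have sumH: "(\<Sum>b\<in>pverts H. f b) = (\<Sum>i<n. f (?w i))" for f :: "'b \<Rightarrow> real"
    using sum_vertex_list[OF fin(2), of f] ord by simp
  have orth_col: "(\<Sum>b\<in>pverts H. p b a * p b a') = of_bool (a = a')"
    if aa: "a \<in> pverts G" "a' \<in> pverts G" for a a'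
  proof -
    obtain i j where ij: "i < n" "j < n" "a = ?v i" "a' = ?v j"
      using exG[OF aa(1)] exG[OF aa(2)] by blast
    have "(\<Sum>b\<in>pverts H. p b a * p b a') = (transpose_mat P * P) $$ (i, j)"
      using ij Pc(1) by (simp add: sumH p_nth scalar_prod_def atLeast0LessThan)
    then show ?thesis
      using ij index unfolding Pc(2) by simp
  qed
  have orth_row: "(\<Sum>a\<in>pverts G. p b a * p b' a) = of_bool (b = b')"
    if bb: "b \<in> pverts H" "b' \<in> pverts H" for b b'
  proof -
    obtain i j where ij: "i < n" "j < n" "b = ?w i" "b' = ?w j"
      using exH[OF bb(1)] exH[OF bb(2)] by blast
    have "(\<Sum>a\<in>pverts G. p b a * p b' a) = (P * transpose_mat P) $$ (i, j)"
      using ij Pc(1) by (simp add: sumG p_nth scalar_prod_def atLeast0LessThan)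
    then show ?thesis
      using ij index unfolding Pc(3) by simp
  qed
  have "(\<Sum>a'\<in>pverts G. p b a' * adj G a' a) = (\<Sum>b'\<in>pverts H. adj H b b' * p b' a)"
    if ab: "a \<in> pverts G" "b \<in> pverts H" for a b
  proof -
    let ?S = "\<Sum>a'\<in>pverts G. p b a' * adj G a' a" and ?T = "\<Sum>b'\<in>pverts H. adj H b b' * p b' a"
    obtain i j where ij: "i < n" "j < n" "b = ?w i" "a = ?v j"
      using exG[OF ab(1)] exH[OF ab(2)] by blast
    have "(\<Sum>a'\<in>pverts G. p b a' * graph_entry X G a' a) = (P * ?M) $$ (i, j)"
      using ij Pc(1) ord
      by (simp add: sumG p_nth scalar_prod_def atLeast0LessThan matrix_of_eq_graph_entry[OF fin(1)])
    moreover have "(\<Sum>b'\<in>pverts H. graph_entry X H b b' * p b' a) = (?N * P) $$ (i, j)"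
      using ij Pc(1) ord
      by (simp add: sumH p_nth scalar_prod_def atLeast0LessThan matrix_of_eq_graph_entry[OF fin(2)])
    moreover have "(\<Sum>a'\<in>pverts G. p b a' * graph_entry X G a' a)
        = (\<Sum>a'\<in>pverts G. (if a' = a then diag_weight X r * p b a else 0)
            + arc_weight X r r * (p b a' * adj G a' a))"
      using ab by (intro sum.cong) (auto simp: graph_entry_regular[OF r(1)] algebra_simps)
    then have "(\<Sum>a'\<in>pverts G. p b a' * graph_entry X G a' a)
        = diag_weight X r * p b a + arc_weight X r r * ?S"
      using fin ab by (simp add: sum.distrib sum_distrib_left)
    moreover have "(\<Sum>b'\<in>pverts H. graph_entry X H b b' * p b' a)
        = (\<Sum>b'\<in>pverts H. (if b = b' then diag_weight X r * p b a else 0)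
            + arc_weight X r r * (adj H b b' * p b' a))"
      using ab by (intro sum.cong) (auto simp: graph_entry_regular[OF r(2)] algebra_simps)
    then have "(\<Sum>b'\<in>pverts H. graph_entry X H b b' * p b' a)
        = diag_weight X r * p b a + arc_weight X r r * ?T"
      using fin ab by (simp add: sum.distrib sum_distrib_left)
    \<comment> \<open>The diagonal contributions on the two sides of \<open>P M = N P\<close> are
      equal and cancel.\<close>
    ultimately have eq: "arc_weight X r r * ?S = arc_weight X r r * ?T"
      unfolding PM by linarith
    show ?thesis
    \<comment> \<open>For \<open>r = 0\<close> the arc weight of the normalized Laplacian is 0 and
      cannot be cancelled, but then there are no arcs and both sums vanish.\<close>
    proof (cases "r = 0")
      case True
      then show ?thesis
        using ab r by (simp add: adj_eq_0_of_degree_0[OF G] adj_eq_0_of_degree_0[OF H])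
    next
      case False
      then have "arc_weight X r r \<noteq> 0" by (cases X) auto
      with eq show ?thesis by simp
    qed
  qed
  with orth_col orth_row have "intertwiner G H p"
    by (simp add: intertwiner_def)
  moreover have "(\<Sum>a\<in>pverts G. p b a) = 1" if b: "b \<in> pverts H" for b
  proof -
    obtain i where i: "i < n" "b = ?w i" using exH[OF b] by blast
    have "(\<Sum>a\<in>pverts G. p b a) * (1 / sqrt n) = (P *\<^sub>v ?e) $ i"
      using i Pc(1) by (simp add: sumG p_nth scalar_prod_def atLeast0LessThan sum_divide_distrib)
    then show ?thesis
      unfolding Pe using i pos by simp
  qed
  ultimately show thesis by (rule that)
qed

section \<open>The NNS join\<close>

lemma pverts_nns_join: "pverts (nns_join G1 G2) = (pverts G1 <+> pverts G2) <+> pverts G1"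
  by (simp add: nns_join_def graph_join_def)

lemma order_of_nns_join:
  assumes "pair_graph G1" "pair_graph G2"
  shows "order_of (nns_join G1 G2) = order_of G1 + order_of G2 + order_of G1"
  using pair_graphD(1)[OF assms(1)] pair_graphD(1)[OF assms(2)]
  by (simp add: order_of_def pverts_nns_join card_Plus)

lemma sum_nns_join:
  fixes f :: "('a + 'b) + 'a \<Rightarrow> real"
  assumes "pair_graph G1" "pair_graph G2"
  shows "(\<Sum>x\<in>pverts (nns_join G1 G2). f x)
    = (\<Sum>u\<in>pverts G1. f (Inl (Inl u))) + (\<Sum>v\<in>pverts G2. f (Inl (Inr v)))
      + (\<Sum>u\<in>pverts G1. f (Inr u))"
  using pair_graphD(1)[OF assms(1)] pair_graphD(1)[OF assms(2)]
  by (simp add: pverts_nns_join sum.Plus comp_def)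

lemma adj_nns_join [simp]:
  "adj (nns_join G1 G2) (Inl (Inl u)) (Inl (Inl u')) = adj G1 u u'"
  "adj (nns_join G1 G2) (Inl (Inr v)) (Inl (Inr v')) = adj G2 v v'"
  "adj (nns_join G1 G2) (Inr u) (Inr u') = 0"
  "adj (nns_join G1 G2) (Inl (Inr v)) (Inr u) = 0"
  "adj (nns_join G1 G2) (Inr u) (Inl (Inr v)) = 0"
  "u \<in> pverts G1 \<Longrightarrow> v \<in> pverts G2 \<Longrightarrow> adj (nns_join G1 G2) (Inl (Inl u)) (Inl (Inr v)) = 1"
  "u \<in> pverts G1 \<Longrightarrow> v \<in> pverts G2 \<Longrightarrow> adj (nns_join G1 G2) (Inl (Inr v)) (Inl (Inl u)) = 1"
  by (auto simp: adj_def nns_join_def graph_join_def)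

text \<open>The block between originals and copies is \<open>J - I - A\<close>, with
  \<open>J\<close> all ones: the adjacency matrix of the complement of \<open>G1\<close>.\<close>

lemma adj_nns_join_copy:
  assumes "pair_graph G1" "u \<in> pverts G1" "u' \<in> pverts G1"
  shows "adj (nns_join G1 G2) (Inl (Inl u)) (Inr u') = 1 - of_bool (u = u') - adj G1 u u'"
    "adj (nns_join G1 G2) (Inr u) (Inl (Inl u')) = 1 - of_bool (u = u') - adj G1 u u'"
  using assms(2,3) pair_graphD(3,4)[OF assms(1)]
  by (auto simp: adj_def nns_join_def graph_join_def irrefl_def dest: symD)

text \<open>An original vertex gains from the copies exactly the \<open>G1\<close>-neighbours it
  lacks, so its own degree in \<open>G1\<close> cancels out. The equations are additive to avoid
  truncated subtraction.\<close>

lemma degree_of_nns_join: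
  assumes G1: "pair_graph G1" and G2: "pair_graph G2"
  shows "u \<in> pverts G1 \<Longrightarrow> degree_of (nns_join G1 G2) (Inl (Inl u)) + 1 = order_of G1 + order_of G2"
    "v \<in> pverts G2 \<Longrightarrow> degree_of (nns_join G1 G2) (Inl (Inr v)) = degree_of G2 v + order_of G1"
    "u \<in> pverts G1 \<Longrightarrow> degree_of (nns_join G1 G2) (Inr u) + degree_of G1 u + 1 = order_of G1"
proof -
  let ?N = "nns_join G1 G2"
  note deg = sum_adj[OF pair_graph_nns_join[OF G1 G2], unfolded sum_nns_join[OF G1 G2], symmetric]
  have co: "(\<Sum>u'\<in>pverts G1. 1 - of_bool (u = u') - adj G1 u u')
      = real (order_of G1) - 1 - degree_of G1 u" if "u \<in> pverts G1" for u
    using pair_graphD(1)[OF G1] that by (simp add: sum_subtractf sum_adj[OF G1] order_of_def)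
  {
    assume u: "u \<in> pverts G1"
    have "real (degree_of ?N (Inl (Inl u))) + 1 = real (order_of G1) + order_of G2"
      using u by (simp add: deg adj_nns_join_copy[OF G1] co sum_adj[OF G1] order_of_def[of G2])
    then show "degree_of ?N (Inl (Inl u)) + 1 = order_of G1 + order_of G2"
      by linarith
    have "real (degree_of ?N (Inr u)) + degree_of G1 u + 1 = order_of G1"
      using u by (simp add: deg adj_nns_join_copy[OF G1] co)
    then show "degree_of ?N (Inr u) + degree_of G1 u + 1 = order_of G1"
      by linarith
  }
  assume v: "v \<in> pverts G2"
  have "real (degree_of ?N (Inl (Inr v))) = degree_of G2 v + real (order_of G1)"
    using v by (simp add: deg sum_adj[OF G2] order_of_def[of G1])
  then show "degree_of ?N (Inl (Inr v)) = degree_of G2 v + order_of G1"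
    by linarith
qed

text \<open>With orders n1 and n2, an original vertex has degree \<open>n1 + n2 - 1\<close> and its
  copy at most \<open>n1 - 1\<close>, which differ as soon as \<open>G2\<close> has a
  vertex.\<close>

lemma nns_join_not_regular:
  assumes G1: "pair_graph G1" and G2: "pair_graph G2"
    and ne: "pverts G1 \<noteq> {}" "pverts G2 \<noteq> {}"
  shows "\<not> regular (nns_join G1 G2)"
proof
  assume "regular (nns_join G1 G2)"
  then obtain d where d: "\<And>x. x \<in> pverts (nns_join G1 G2) \<Longrightarrow> degree_of (nns_join G1 G2) x = d"
    by (auto simp: regular_def)
  obtain u where u: "u \<in> pverts G1" using ne by auto
  have "order_of G2 > 0"
    using ne pair_graphD(1)[OF G2] by (simp add: order_of_def card_gt_0_iff)
  moreover have "degree_of (nns_join G1 G2) (Inl (Inl u)) = degree_of (nns_join G1 G2) (Inr u)"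
    using u d[of "Inl (Inl u)"] d[of "Inr u"] by (simp add: pverts_nns_join InlI InrI)
  ultimately show False
    using degree_of_nns_join(1,3)[OF G1 G2 u] by linarith
qed

section \<open>The block diagonal intertwiner\<close>

text \<open>Originals and copies carry the same block \<open>p\<close>, so that the block
  \<open>J - I - A\<close> between them is intertwined as well.\<close>

fun nns_intertwiner ::
  "('b \<Rightarrow> 'a \<Rightarrow> real) \<Rightarrow> ('d \<Rightarrow> 'c \<Rightarrow> real) \<Rightarrow> ('b + 'd) + 'b \<Rightarrow> ('a + 'c) + 'a \<Rightarrow> real" where
  "nns_intertwiner p q (Inl (Inl b)) (Inl (Inl a)) = p b a"
| "nns_intertwiner p q (Inl (Inr d)) (Inl (Inr c)) = q d c"
| "nns_intertwiner p q (Inr b) (Inr a) = p b a"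
| "nns_intertwiner p q _ _ = 0"

text \<open>
  Every block of the adjacency matrix is a combination of \<open>A\<close>, the identity and all-ones matrices;
  the latter are respected because both \<open>p\<close> and \<open>q\<close> fix the all-ones vector.
\<close>

lemma intertwiner_nns_join:
  assumes G1: "pair_graph G1" and H1: "pair_graph H1" and G2: "pair_graph G2" and H2: "pair_graph H2"
    and p: "intertwiner G1 H1 p" "\<And>b. b \<in> pverts H1 \<Longrightarrow> (\<Sum>a\<in>pverts G1. p b a) = 1"
    and q: "intertwiner G2 H2 q" "\<And>b. b \<in> pverts H2 \<Longrightarrow> (\<Sum>a\<in>pverts G2. q b a) = 1"
  shows "intertwiner (nns_join G1 G2) (nns_join H1 H2) (nns_intertwiner p q)"
proof -
  let ?G = "nns_join G1 G2" and ?H = "nns_join H1 H2" and ?p = "nns_intertwiner p q"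
  note sums = sum_nns_join[OF G1 G2] sum_nns_join[OF H1 H2]
  \<comment> \<open>An all-ones block is intertwined when its left factor has row sums 1 and its
    right factor column sums 1, so column sums are needed in addition to the given row sums.\<close>
  have pc: "(\<Sum>b\<in>pverts H1. p b a) = 1" if "a \<in> pverts G1" for a
    by (rule intertwiner_col_sum[OF G1 p(1) _ that]) (rule p(2))
  have qc: "(\<Sum>b\<in>pverts H2. q b a) = 1" if "a \<in> pverts G2" for a
    by (rule intertwiner_col_sum[OF G2 q(1) _ that]) (rule q(2))
  note fin = pair_graphD(1)[OF G1] pair_graphD(1)[OF H1]
  have col: "(\<Sum>b\<in>pverts ?H. ?p b a * ?p b a') = of_bool (a = a')"
    if "a \<in> pverts ?G" "a' \<in> pverts ?G" for a a'
    unfolding sums using that p(1) q(1) unfolding pverts_nns_join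
    by (elim PlusE) (simp_all add: intertwiner_def)
  have row: "(\<Sum>a\<in>pverts ?G. ?p b a * ?p b' a) = of_bool (b = b')"
    if "b \<in> pverts ?H" "b' \<in> pverts ?H" for b b'
    unfolding sums using that p(1) q(1) unfolding pverts_nns_join
    by (elim PlusE) (simp_all add: intertwiner_def)
  have co: "(\<Sum>a'\<in>pverts G1. p b a' * (1 - of_bool (a' = a) - adj G1 a' a))
      = (\<Sum>b'\<in>pverts H1. (1 - of_bool (b = b') - adj H1 b b') * p b' a)"
    if ab: "a \<in> pverts G1" "b \<in> pverts H1" for a b
  proof -
    have "(\<Sum>a'\<in>pverts G1. p b a' * (1 - of_bool (a' = a) - adj G1 a' a))
        = (\<Sum>a'\<in>pverts G1. p b a') - (\<Sum>a'\<in>pverts G1. if a' = a then p b a' else 0)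
          - (\<Sum>a'\<in>pverts G1. p b a' * adj G1 a' a)"
      unfolding sum_subtractf[symmetric] by (intro sum.cong) (auto simp: algebra_simps)
    also have "\<dots> = (\<Sum>b'\<in>pverts H1. p b' a) - (\<Sum>b'\<in>pverts H1. if b = b' then p b' a else 0)
          - (\<Sum>b'\<in>pverts H1. adj H1 b b' * p b' a)"
      using ab fin p pc[OF ab(1)] by (simp add: intertwiner_def)
    also have "\<dots> = (\<Sum>b'\<in>pverts H1. (1 - of_bool (b = b') - adj H1 b b') * p b' a)"
      unfolding sum_subtractf[symmetric] by (intro sum.cong) (auto simp: algebra_simps)
    finally show ?thesis .
  qed
  have "(\<Sum>a'\<in>pverts ?G. ?p b a' * adj ?G a' a) = (\<Sum>b'\<in>pverts ?H. adj ?H b b' * ?p b' a)"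
    if "b \<in> pverts ?H" "a \<in> pverts ?G" for a b
    unfolding sums using that p(1) q(1) unfolding pverts_nns_join
    by (elim PlusE)
      (simp_all add: intertwiner_def co p(2) q(2) pc qc adj_nns_join_copy[OF G1] adj_nns_join_copy[OF H1])
  with col row show ?thesis
    by (simp add: intertwiner_def)
qed

section \<open>Isomorphisms\<close>

text \<open>A digraph isomorphism has separate maps for vertices, arcs, heads and tails. Here arcs
  are pairs of vertices, so the vertex map determines the arc map.\<close>

lemma isomorphic_iff_bij_betw:
  assumes G: "pair_graph G" and H: "pair_graph H"
  shows "isomorphic G H \<longleftrightarrow> (\<exists>f. bij_betw f (pverts G) (pverts H)
    \<and> (\<forall>u\<in>pverts G. \<forall>v\<in>pverts G. (u, v) \<in> parcs G \<longleftrightarrow> (f u, f v) \<in> parcs H))"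
proof
  assume "isomorphic G H"
  then obtain h where h: "pre_digraph.digraph_isomorphism (with_proj G) h"
    and H_eq: "with_proj H = app_iso h (with_proj G)"
    by (auto simp: isomorphic_def digraph_iso_def)
  let ?f = "iso_verts h"
  have inj: "inj_on ?f (pverts G)"
    and ends: "\<And>a. a \<in> parcs G \<Longrightarrow> ?f (fst a) = iso_tail h (iso_arcs h a) \<and> ?f (snd a) = iso_head h (iso_arcs h a)"
    using h by (auto simp: pre_digraph.digraph_isomorphism_def)
  \<comment> \<open>Equality of the digraph records forces the tail and head maps to be the
    projections.\<close>
  have proj: "pverts H = ?f ` pverts G" "parcs H = iso_arcs h ` parcs G" "iso_tail h = fst" "iso_head h = snd"
    using arg_cong[OF H_eq, of verts] arg_cong[OF H_eq, of arcs]
      arg_cong[OF H_eq, of tail] arg_cong[OF H_eq, of head] by simp_all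
  have "iso_arcs h (u, v) = (?f u, ?f v)" if "(u, v) \<in> parcs G" for u v
    using ends[OF that] proj(3,4) by (simp add: prod_eq_iff)
  then have arcs: "parcs H = (\<lambda>(u, v). (?f u, ?f v)) ` parcs G"
    unfolding proj(2) by (intro image_cong) auto
  have "(u, v) \<in> parcs G \<longleftrightarrow> (?f u, ?f v) \<in> parcs H" if "u \<in> pverts G" "v \<in> pverts G" for u v
  proof
    assume "(?f u, ?f v) \<in> parcs H"
    then obtain u' v' where "(u', v') \<in> parcs G" "?f u = ?f u'" "?f v = ?f v'"
      unfolding arcs by auto
    then show "(u, v) \<in> parcs G"
      using inj_onD[OF inj] that pair_graphD(2)[OF G] by (metis SigmaE2 subsetD)
  qed (auto simp: arcs)
  then show "\<exists>f. bij_betw f (pverts G) (pverts H)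
    \<and> (\<forall>u\<in>pverts G. \<forall>v\<in>pverts G. (u, v) \<in> parcs G \<longleftrightarrow> (f u, f v) \<in> parcs H)"
    using inj proj(1) by (intro exI[of _ ?f]) (simp add: bij_betw_def)
next
  assume "\<exists>f. bij_betw f (pverts G) (pverts H)
    \<and> (\<forall>u\<in>pverts G. \<forall>v\<in>pverts G. (u, v) \<in> parcs G \<longleftrightarrow> (f u, f v) \<in> parcs H)"
  then obtain f where f: "inj_on f (pverts G)" "pverts H = f ` pverts G"
    and arc: "\<And>u v. u \<in> pverts G \<Longrightarrow> v \<in> pverts G \<Longrightarrow> (u, v) \<in> parcs G \<longleftrightarrow> (f u, f v) \<in> parcs H"
    by (auto simp: bij_betw_def)
  define h where "h = \<lparr>iso_verts = f, iso_arcs = (\<lambda>(u, v). (f u, f v)), iso_head = snd, iso_tail = fst\<rparr>"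
  interpret G: pair_graph G by fact
  note sub = pair_graphD(2)[OF G]
  have "inj_on (\<lambda>(u, v). (f u, f v)) (parcs G)"
    using inj_onD[OF f(1)] sub by (intro inj_onI) (auto simp: subset_iff)
  then have "pre_digraph.digraph_isomorphism (with_proj G) h"
    using f(1) G.wf_digraph_axioms
    by (auto simp: pre_digraph.digraph_isomorphism_def h_def)
  moreover have "parcs H = (\<lambda>(u, v). (f u, f v)) ` parcs G"
  proof (intro equalityI subsetI)
    fix e assume e: "e \<in> parcs H"
    then obtain u v where "e = (f u, f v)" "u \<in> pverts G" "v \<in> pverts G"
      using pair_graphD(2)[OF H] f(2) by auto
    with e arc show "e \<in> (\<lambda>(u, v). (f u, f v)) ` parcs G" by auto
  next
    fix e assume "e \<in> (\<lambda>(u, v). (f u, f v)) ` parcs G"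
    then show "e \<in> parcs H" using arc sub by auto
  qed
  then have "with_proj H = app_iso h (with_proj G)"
    using f(2) by (simp add: with_proj_def app_iso_def h_def)
  ultimately show "isomorphic G H"
    unfolding isomorphic_def digraph_iso_def by blast
qed

lemma degree_of_isomorphism:
  assumes G: "pair_graph G" and H: "pair_graph H" and f: "bij_betw f (pverts G) (pverts H)"
    and arc: "\<And>u v. u \<in> pverts G \<Longrightarrow> v \<in> pverts G \<Longrightarrow> (u, v) \<in> parcs G \<longleftrightarrow> (f u, f v) \<in> parcs H"
    and u: "u \<in> pverts G"
  shows "degree_of H (f u) = degree_of G u"
proof -
  have "real (degree_of H (f u)) = (\<Sum>v\<in>pverts G. adj H (f u) (f v))"
    unfolding sum_adj[OF H, symmetric] by (rule sum.reindex_bij_betw[OF f, symmetric])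
  also have "\<dots> = degree_of G u"
    unfolding sum_adj[OF G, symmetric] using arc u by (intro sum.cong) (auto simp: adj_def)
  finally show ?thesis by simp
qed

text \<open>The neighbours of \<open>u\<close> lie among the other vertices and, by cardinality,
  exhaust them.\<close>

lemma complete_of_degree:
  assumes G: "pair_graph G" and u: "u \<in> pverts G" "v \<in> pverts G" "u \<noteq> v"
    and deg: "degree_of G u + 1 = order_of G"
  shows "(u, v) \<in> parcs G"
proof -
  have "{v \<in> pverts G. (u, v) \<in> parcs G} = pverts G - {u}"
  proof (rule card_subset_eq)
    show "card {v \<in> pverts G. (u, v) \<in> parcs G} = card (pverts G - {u})"
      using deg u pair_graphD(1)[OF G] by (simp add: degree_of_eq_card[OF G] order_of_def)
  qed (use pair_graphD(1,4)[OF G] in \<open>auto simp: irrefl_def\<close>)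
  with u show ?thesis by blast
qed

text \<open>
  Unless \<open>G2\<close> is complete, its vertices are the only ones of degree \<open>r + n\<^sub>1\<close> in the NNS join: original
  vertices of \<open>G1\<close> have larger degree and new vertices have degree below \<open>n\<^sub>1\<close>.
\<close>

lemma isomorphic_of_isomorphic_nns_join:
  assumes G1: "pair_graph G1" and H1: "pair_graph H1" and G2: "pair_graph G2" and H2: "pair_graph H2"
    and ord: "order_of G1 = order_of H1" "order_of G2 = order_of H2"
    and r: "\<And>v. v \<in> pverts G2 \<Longrightarrow> degree_of G2 v = r" "\<And>v. v \<in> pverts H2 \<Longrightarrow> degree_of H2 v = r"
    and iso: "isomorphic (nns_join G1 G2) (nns_join H1 H2)"
  shows "isomorphic G2 H2"
proof (cases "r + 1 = order_of G2")
  case True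
  \<comment> \<open>In this case degrees cannot separate \<open>G2\<close> from the originals of
    \<open>G1\<close>, but \<open>G2\<close> and \<open>H2\<close> are complete of the same order,
    so any bijection works.\<close>
  obtain f where f: "bij_betw f (pverts G2) (pverts H2)"
    using ord(2) pair_graphD(1)[OF G2] pair_graphD(1)[OF H2] finite_same_card_bij
    unfolding order_of_def by blast
  have "(u, v) \<in> parcs G2 \<longleftrightarrow> (f u, f v) \<in> parcs H2" if uv: "u \<in> pverts G2" "v \<in> pverts G2" for u v
  proof (cases "u = v")
    case True
    then show ?thesis
      using pair_graphD(4)[OF G2] pair_graphD(4)[OF H2] by (auto simp: irrefl_def)
  next
    case False
    have fv: "f u \<in> pverts H2" "f v \<in> pverts H2" "f u \<noteq> f v"
      using f uv False by (auto simp: bij_betw_def inj_on_def)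
    have "(u, v) \<in> parcs G2"
      using True r(1)[OF uv(1)] by (intro complete_of_degree[OF G2 uv False]) simp
    moreover have "(f u, f v) \<in> parcs H2"
      using True r(2)[OF fv(1)] ord(2) by (intro complete_of_degree[OF H2 fv]) simp
    ultimately show ?thesis by simp
  qed
  with f show ?thesis
    unfolding isomorphic_iff_bij_betw[OF G2 H2] by blast
next
  case False
  let ?G = "nns_join G1 G2" and ?H = "nns_join H1 H2"
  note PG = pair_graph_nns_join[OF G1 G2] and PH = pair_graph_nns_join[OF H1 H2]
  obtain f where f: "bij_betw f (pverts ?G) (pverts ?H)"
    and arc: "\<And>x y. x \<in> pverts ?G \<Longrightarrow> y \<in> pverts ?G \<Longrightarrow> (x, y) \<in> parcs ?G \<longleftrightarrow> (f x, f y) \<in> parcs ?H"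
    using iso unfolding isomorphic_iff_bij_betw[OF PG PH] by blast
  have ex: "\<exists>w\<in>pverts H2. f (Inl (Inr v)) = Inl (Inr w)" if v: "v \<in> pverts G2" for v
  proof -
    have x: "Inl (Inr v) \<in> pverts ?G" using v by (simp add: pverts_nns_join InlI InrI)
    let ?y = "f (Inl (Inr v))"
    have "?y \<in> pverts ?H" using bij_betwE[OF f] x by blast
    moreover have deg: "degree_of ?H ?y = r + order_of H1"
      using degree_of_isomorphism[OF PG PH f arc x] degree_of_nns_join(2)[OF G1 G2 v] r(1)[OF v] ord
      by simp
    ultimately show ?thesis
      unfolding pverts_nns_join
    \<comment> \<open>An original vertex of \<open>H1\<close> as image would force
      \<open>r + 1 = order_of G2\<close>, the excluded case; a copy has degree below
      \<open>order_of H1\<close>.\<close>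
    proof (elim PlusE)
      fix z u assume "?y = Inl z" "z = Inl u" "u \<in> pverts H1"
      then show ?thesis
        using degree_of_nns_join(1)[OF H1 H2, of u] deg False ord by simp
    next
      fix u assume "?y = Inr u" "u \<in> pverts H1"
      then show ?thesis
        using degree_of_nns_join(3)[OF H1 H2, of u] deg by simp
    qed auto
  qed
  then obtain g where g: "\<And>v. v \<in> pverts G2 \<Longrightarrow> g v \<in> pverts H2 \<and> f (Inl (Inr v)) = Inl (Inr (g v))"
    by metis
  have x: "Inl (Inr v) \<in> pverts ?G" if "v \<in> pverts G2" for v
    using that by (simp add: pverts_nns_join InlI InrI)
  have "inj_on g (pverts G2)"
  proof (rule inj_onI)
    fix u v assume uv: "u \<in> pverts G2" "v \<in> pverts G2" "g u = g v"
    then have "f (Inl (Inr u)) = f (Inl (Inr v))" using g by simp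
    then show "u = v"
      using inj_onD[OF bij_betw_imp_inj_on[OF f] _ x[OF uv(1)] x[OF uv(2)]] by simp
  qed
  moreover have "g ` pverts G2 = pverts H2"
  \<comment> \<open>Injectivity and equal orders give surjectivity, so the inverse isomorphism need
    not be analysed.\<close>
  proof (rule card_subset_eq)
    show "card (g ` pverts G2) = card (pverts H2)"
      using card_image[OF \<open>inj_on g (pverts G2)\<close>] ord(2) by (simp add: order_of_def)
  qed (use g pair_graphD(1)[OF H2] in auto)
  moreover have "(u, v) \<in> parcs G2 \<longleftrightarrow> (g u, g v) \<in> parcs H2" if "u \<in> pverts G2" "v \<in> pverts G2" for u v
    using arc[OF x[OF that(1)] x[OF that(2)]] g[OF that(1)] g[OF that(2)]
    by (simp add: nns_join_def graph_join_def)
  ultimately show ?thesis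
    unfolding isomorphic_iff_bij_betw[OF G2 H2] bij_betw_def by blast
qed

section \<open>Combining spectrum, degrees and isomorphism\<close>

lemma isomorphic_of_order_0:
  assumes "pair_graph G" "pair_graph H" "pverts G = {}" "order_of G = order_of H"
  shows "isomorphic G H"
  using assms pair_graphD(1)[OF assms(2)]
  by (auto simp: isomorphic_iff_bij_betw order_of_def bij_betw_def)

theorem corollary6p5:
  fixes G1 :: "'a pair_pre_digraph" and H1 :: "'b pair_pre_digraph"
    and G2 :: "'c pair_pre_digraph" and H2 :: "'d pair_pre_digraph"
  assumes "pair_graph G1" "pair_graph H1" "pair_graph G2" "pair_graph H2"
    and "pverts G1 \<noteq> {}"
    and "regular G1" "regular H1" "cospectral G1 H1"
    and "regular G2" "regular H2" "cospectral G2 H2" "\<not> isomorphic G2 H2"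
  shows "\<not> regular (nns_join G1 G2) \<and> \<not> regular (nns_join H1 H2)
    \<and> NICS {Adjacency, Laplacian, Signless_Laplacian, Normalized_Laplacian}
          (nns_join G1 G2) (nns_join H1 H2)"
proof -
  note graphs = assms(1-4)
  obtain X Y where X: "cospectral_wrt X G1 H1" and Y: "cospectral_wrt Y G2 H2"
    using assms(8,11) by (auto simp: cospectral_def)
  have ord: "order_of G1 = order_of H1" "order_of G2 = order_of H2"
    using cospectral_wrt_order[OF graphs(1,2) X] cospectral_wrt_order[OF graphs(3,4) Y] .
  \<comment> \<open>If \<open>G2\<close> were empty, so would be \<open>H2\<close>, and the two
    would be isomorphic.\<close>
  have ne2: "pverts G2 \<noteq> {}"
    using isomorphic_of_order_0[OF graphs(3,4) _ ord(2)] assms(12) by blast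
  have neH: "pverts H1 \<noteq> {}" "pverts H2 \<noteq> {}"
    using ord assms(5) ne2 pair_graphD(1)[OF graphs(1)] pair_graphD(1)[OF graphs(3)]
    by (auto simp: order_of_def)
  \<comment> \<open>Regularity gives each graph its own degree; cospectrality identifies the
    two.\<close>
  obtain r where r: "\<And>v. v \<in> pverts G1 \<Longrightarrow> degree_of G1 v = r" "\<And>v. v \<in> pverts H1 \<Longrightarrow> degree_of H1 v = r"
    using assms(6,7) regular_cospectral_same_degree[OF graphs(1,2) _ _ X assms(5)]
    unfolding regular_def by metis
  obtain s where s: "\<And>v. v \<in> pverts G2 \<Longrightarrow> degree_of G2 v = s" "\<And>v. v \<in> pverts H2 \<Longrightarrow> degree_of H2 v = s"
    using assms(9,10) regular_cospectral_same_degree[OF graphs(3,4) _ _ Y ne2]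
    unfolding regular_def by metis
  obtain p where p: "intertwiner G1 H1 p" "\<And>b. b \<in> pverts H1 \<Longrightarrow> (\<Sum>a\<in>pverts G1. p b a) = 1"
    using regular_cospectral_intertwiner[OF graphs(1,2) r X assms(5)] by blast
  obtain q where q: "intertwiner G2 H2 q" "\<And>b. b \<in> pverts H2 \<Longrightarrow> (\<Sum>a\<in>pverts G2. q b a) = 1"
    using regular_cospectral_intertwiner[OF graphs(3,4) s Y ne2] by blast
  let ?G = "nns_join G1 G2" and ?H = "nns_join H1 H2"
  note dG = degree_of_nns_join[OF graphs(1,3)] and dH = degree_of_nns_join[OF graphs(2,4)]
  \<comment> \<open>In each of the three vertex classes the degree depends only on the orders and on
    \<open>r\<close> or \<open>s\<close>, which both joins share.\<close>
  have deg: "a \<in> pverts G1 \<Longrightarrow> b \<in> pverts H1 \<Longrightarrow> degree_of ?G (Inl (Inl a)) = degree_of ?H (Inl (Inl b))"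
    "c \<in> pverts G2 \<Longrightarrow> d \<in> pverts H2 \<Longrightarrow> degree_of ?G (Inl (Inr c)) = degree_of ?H (Inl (Inr d))"
    "a \<in> pverts G1 \<Longrightarrow> b \<in> pverts H1 \<Longrightarrow> degree_of ?G (Inr a) = degree_of ?H (Inr b)" for a b c d
    using dG(1)[of a] dH(1)[of b] dG(2)[of c] dH(2)[of d] dG(3)[of a] dH(3)[of b]
      ord r(1)[of a] r(2)[of b] s(1)[of c] s(2)[of d] by linarith+
  have "cospectral_wrt Z ?G ?H" for Z
  proof (rule intertwiner_degree_imp_cospectral_wrt)
    show "pair_graph ?G" "pair_graph ?H"
      using graphs by (simp_all add: pair_graph_nns_join)
    show "order_of ?G = order_of ?H"
      using graphs ord by (simp add: order_of_nns_join)
    show "intertwiner ?G ?H (nns_intertwiner p q)"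
      by (rule intertwiner_nns_join[OF graphs p q])
    fix x y assume "x \<in> pverts ?G" "y \<in> pverts ?H" "nns_intertwiner p q y x \<noteq> 0"
    \<comment> \<open>A nonzero entry of the block diagonal matrix joins vertices of the same
      class.\<close>
    then show "degree_of ?G x = degree_of ?H y"
      unfolding pverts_nns_join by (elim PlusE) (simp_all add: deg)
  qed
  moreover have "\<not> isomorphic ?G ?H"
    using isomorphic_of_isomorphic_nns_join[OF graphs ord s] assms(12) by blast
  ultimately show ?thesis
    using nns_join_not_regular[OF graphs(1,3) assms(5) ne2] nns_join_not_regular[OF graphs(2,4) neH]
    by (simp add: NICS_def)
qed

end
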